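(* Let $m\ge 1$. For $\Phi,\Psi\in\mathcal{S}_+^{m\times m}(\mathbb{T})$ define $$\tilde d_H(\Phi,\Psi)=\Big[\inf\big\{\|W_\Psi-W_\Phi\|_2^2:\ W_\Psi,W_\Phi\in L^2_{m\times m},\ W_\Psi W_\Psi^*=\Psi,\ W_\Phi W_\Phi^*=\Phi\big\}\Big]^{1/2}.$$ Then the following facts hold. 1) For all $\Phi,\Psi\in\mathcal{S}_+^{m\times m}(\mathbb{T})$ and any square spectral factor $\bar W_\Psi$ of $\Psi$, $$\tilde d_H(\Phi,\Psi)=\Big[\inf\big\{\|\bar W_\Psi-W_\Phi\|_2^2:\ W_\Phi\in L^2_{m\times m},\ W_\Phi W_\Phi^*=\Phi\big\}\Big]^{1/2}.$$ 2) The infimum in the formula of item 1) is a minimum: the unique square spectral factor of $\Phi$ attaining it is $$\hat W_\Phi:=\Phi^{1/2}\big(\Phi^{1/2}\Psi\Phi^{1/2}\big)^{-1/2}\Phi^{1/2}\,\bar W_\Psi .$$ 3) $\tilde d_H$ is a bona fide distance function (a metric) on $\mathcal{S}_+^{m\times m}(\mathbb{T})$. 4) In the scalar case $m=1$, $\tilde d_H$ coincides with the Hellinger distance $$d_H(\Phi,\Psi)=\Big[\int_{-\pi}^{\pi}\big(\sqrt{\Phi(e^{i\theta})}-\sqrt{\Psi(e^{i\theta})}\big)^2\frac{d\theta}{2\pi}\Big]^{1/2}.$$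
   Context: $\mathbb{T}$ is the unit circle. $\mathcal{S}_+^{m\times m}(\mathbb{T})$ is the family of bounded, coercive, $\mathbb{C}^{m\times m}$-valued spectral densities: measurable bounded functions $\Phi$ on $\mathbb{T}$ whose values are Hermitian non-negative definite $m\times m$ matrices and for which there is a constant $c_\Phi>0$ with $\Phi(e^{i\theta})-c_\Phi I$ positive definite a.e. on $\mathbb{T}$. Functions equal a.e. are identified. A star denotes conjugate transposition (pointwise on $\mathbb{T}$). Integrals are over $[-\pi,\pi]$ with respect to normalized Lebesgue measure $d\theta/2\pi$. $L^2_{m\times p}$ is the Hilbert space of measurable $F:\mathbb{T}\to\mathbb{C}^{m\times p}$ with $\|F\|_2^2=\int \mathrm{tr}\,FF^*<\infty$. A measurable $\mathbb{C}^{m\times p}$-valued function $W$ is a spectral factor of $\Phi$ if $W(e^{i\theta})W(e^{i\theta})^*=\Phi(e^{i\theta})$ a.e. on $\mathbb{T}$; it is square if $p=m$. For a positive semidefinite Hermitian matrix $M$, $M^{1/2}$ is its unique positive semidefinite Hermitian square root, and $M^{-1/2}$ its inverse when it exists; these operations are applied pointwise on $\mathbb{T}$. *)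

theory Defs
  imports "HOL-Analysis.Analysis"
begin

text \<open>
  A function on the unit circle is represented by a function on \<^typ>\<open>complex\<close> whose values off the
  circle play no role: measurability, almost-everywhere statements and integrals all refer to its
  pullback \<open>\<theta> \<mapsto> F (cis \<theta>)\<close> to the interval from \<open>-\<pi>\<close> to \<open>\<pi>\<close> with (complete) Lebesgue measure.
\<close>

abbreviation arc :: "real measure" where
  "arc \<equiv> lebesgue_on {-pi..pi}"

definition circle_measurable :: "(complex \<Rightarrow> 'b::topological_space) \<Rightarrow> bool" where
  "circle_measurable F \<longleftrightarrow> (\<lambda>\<theta>. F (cis \<theta>)) \<in> borel_measurable arc"

definition AE_circle :: "(complex \<Rightarrow> bool) \<Rightarrow> bool" where
  "AE_circle P \<longleftrightarrow> (AE \<theta> in arc. P (cis \<theta>))"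

definition circle_integrable :: "(complex \<Rightarrow> real) \<Rightarrow> bool" where
  "circle_integrable f \<longleftrightarrow> integrable arc (\<lambda>\<theta>. f (cis \<theta>))"

definition circle_integral :: "(complex \<Rightarrow> real) \<Rightarrow> real" where
  "circle_integral f = (LINT \<theta>|arc. f (cis \<theta>)) / (2 * pi)"

definition ctranspose :: "complex^'n^'m \<Rightarrow> complex^'m^'n" where
  "ctranspose A = (\<chi> i j. cnj (A $ j $ i))"

definition hermitian :: "complex^'n^'n \<Rightarrow> bool" where
  "hermitian A \<longleftrightarrow> ctranspose A = A"

definition quad_form :: "complex^'n^'n \<Rightarrow> complex^'n \<Rightarrow> complex" where
  "quad_form A v = (\<Sum>i\<in>UNIV. cnj (v $ i) * (A *v v) $ i)"

text \<open>The real parts below lose nothing: the form of a Hermitian matrix is real-valued.\<close>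

definition pos_semidef :: "complex^'n^'n \<Rightarrow> bool" where
  "pos_semidef A \<longleftrightarrow> hermitian A \<and> (\<forall>v. 0 \<le> Re (quad_form A v))"

definition pos_def :: "complex^'n^'n \<Rightarrow> bool" where
  "pos_def A \<longleftrightarrow> hermitian A \<and> (\<forall>v. v \<noteq> 0 \<longrightarrow> 0 < Re (quad_form A v))"

definition msqrt :: "complex^'n^'n \<Rightarrow> complex^'n^'n" where
  "msqrt A = (THE S. pos_semidef S \<and> S ** S = A)"

text \<open>
  The class of spectral densities. Functions equal a.e. are identified, so every pointwise
  condition is imposed a.e.; the set is thus closed under changes on null sets.
\<close>

definition spectral_densities :: "(complex \<Rightarrow> complex^'n^'n) set" where
  "spectral_densities = {\<Phi>. circle_measurable \<Phi>
     \<and> (\<exists>B. AE_circle (\<lambda>z. norm (\<Phi> z) \<le> B))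
     \<and> AE_circle (\<lambda>z. pos_semidef (\<Phi> z))
     \<and> (\<exists>c>0. AE_circle (\<lambda>z. pos_def (\<Phi> z - mat (complex_of_real c))))}"

text \<open>\<open>F ** ctranspose F\<close> has real non-negative trace.\<close>

definition L2 :: "(complex \<Rightarrow> complex^'p^'m) set" where
  "L2 = {F. circle_measurable F \<and> circle_integrable (\<lambda>z. Re (trace (F z ** ctranspose (F z))))}"

definition L2norm :: "(complex \<Rightarrow> complex^'p^'m) \<Rightarrow> real" where
  "L2norm F = sqrt (circle_integral (\<lambda>z. Re (trace (F z ** ctranspose (F z)))))"

definition spectral_factor :: "(complex \<Rightarrow> complex^'m^'m) \<Rightarrow> (complex \<Rightarrow> complex^'p^'m) \<Rightarrow> bool" where
  "spectral_factor \<Phi> W \<longleftrightarrow>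
     circle_measurable W \<and> AE_circle (\<lambda>z. W z ** ctranspose (W z) = \<Phi> z)"

definition dH_tilde ::
  "(complex \<Rightarrow> complex^'n^'n) \<Rightarrow> (complex \<Rightarrow> complex^'n^'n) \<Rightarrow> real" where
  "dH_tilde \<Phi> \<Psi> = sqrt (Inf {(L2norm (\<lambda>z. W\<^sub>\<Psi> z - W\<^sub>\<Phi> z))\<^sup>2 | W\<^sub>\<Psi> W\<^sub>\<Phi> :: complex \<Rightarrow> complex^'n^'n.
     W\<^sub>\<Psi> \<in> L2 \<and> W\<^sub>\<Phi> \<in> L2 \<and> spectral_factor \<Psi> W\<^sub>\<Psi> \<and> spectral_factor \<Phi> W\<^sub>\<Phi>})"

definition W_hat ::
  "(complex \<Rightarrow> complex^'n^'n) \<Rightarrow> (complex \<Rightarrow> complex^'n^'n) \<Rightarrow> (complex \<Rightarrow> complex^'n^'n)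
    \<Rightarrow> complex \<Rightarrow> complex^'n^'n" where
  "W_hat \<Phi> \<Psi> W\<^sub>\<Psi> z =
     msqrt (\<Phi> z) ** matrix_inv (msqrt (msqrt (\<Phi> z) ** \<Psi> z ** msqrt (\<Phi> z))) ** msqrt (\<Phi> z)
       ** W\<^sub>\<Psi> z"

definition ae_rel ::
  "((complex \<Rightarrow> complex^'n^'n) \<times> (complex \<Rightarrow> complex^'n^'n)) set" where
  "ae_rel = {(\<Phi>, \<Psi>). \<Phi> \<in> spectral_densities \<and> \<Psi> \<in> spectral_densities
     \<and> AE_circle (\<lambda>z. \<Phi> z = \<Psi> z)}"

lemma equiv_ae_rel: "equiv spectral_densities ae_rel"
proof (rule equivI)
  show "ae_rel \<subseteq> spectral_densities \<times> spectral_densities"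
    by (auto simp: ae_rel_def)
  show "refl_on spectral_densities ae_rel"
    by (auto simp: refl_on_def ae_rel_def AE_circle_def)
  show "sym ae_rel"
    by (auto simp: sym_def ae_rel_def AE_circle_def eq_commute)
  show "trans ae_rel"
    unfolding trans_def ae_rel_def AE_circle_def by auto
qed

text \<open>
  The function induced by \<^const>\<open>dH_tilde\<close> on a.e.-equality classes, meaningful once
  \<^const>\<open>dH_tilde\<close> is known to respect \<^const>\<open>ae_rel\<close>. The value 0 outside the quotient is a
  dummy, needed because \<^locale>\<open>Metric_space\<close> asks for non-negativity and symmetry of the distance
  on the whole type.
\<close>

definition dH_class ::
  "(complex \<Rightarrow> complex^'n^'n) set \<Rightarrow> (complex \<Rightarrow> complex^'n^'n) set \<Rightarrow> real" where
  "dH_class X Y =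
     (if X \<in> spectral_densities // ae_rel \<and> Y \<in> spectral_densities // ae_rel
      then the_elem (\<Union>\<Phi>\<in>X. \<Union>\<Psi>\<in>Y. {dH_tilde \<Phi> \<Psi>}) else 0)"

definition hellinger :: "(complex \<Rightarrow> real) \<Rightarrow> (complex \<Rightarrow> real) \<Rightarrow> real" where
  "hellinger f g = sqrt (circle_integral (\<lambda>z. (sqrt (f z) - sqrt (g z))\<^sup>2))"

end

theory Submission
  imports Defs
begin

text \<open>
  The problem decouples over the points of the circle, and at each point it is a problem about
  matrices: given positive definite \<open>A\<close> and \<open>B\<close> and a factor \<open>V\<close> of \<open>B\<close> (that is, \<open>V V\<^sup>* = B\<close>), find
  the factor \<open>W\<close> of \<open>A\<close> closest to \<open>V\<close> in the Frobenius norm. Let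
  \<open>T = A\<^sup>1\<^sup>/\<^sup>2 (A\<^sup>1\<^sup>/\<^sup>2 B A\<^sup>1\<^sup>/\<^sup>2)\<^sup>-\<^sup>1\<^sup>/\<^sup>2 A\<^sup>1\<^sup>/\<^sup>2\<close>. This matrix is positive definite and satisfies \<open>T B T = A\<close>,
  so \<open>T V\<close> is a factor of \<open>A\<close>. Completing the square gives, for every factor \<open>W\<close> of \<open>A\<close>,
  \<open>\<parallel>V - W\<parallel>\<^sup>2 - \<parallel>V - T V\<parallel>\<^sup>2 = \<langle>W - T V, T\<^sup>-\<^sup>1 (W - T V)\<rangle>\<close>
  (\<open>transport_gap\<close>). The right-hand side is non-negative and vanishes only at \<open>W = T V\<close>; moreover
  \<open>\<parallel>V - T V\<parallel>\<^sup>2 = tr A + tr B - 2 tr (T B)\<close> does not depend on \<open>V\<close>. Integrated over the circle, these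
  facts say that the closest factor exists, is unique almost everywhere, and lies at a distance
  that is the same for all factors of \<open>\<Psi>\<close> (\<open>factor_cost_le\<close>, \<open>L2norm_diff_W_hat\<close>). This settles the
  first two claims.

  The triangle inequality follows because the factor of the middle density may be prescribed: the
  closest factors \<open>W\<close> of \<open>\<Phi>\<close> and \<open>U\<close> of \<open>\<Omega>\<close> to one factor \<open>V\<close> of \<open>\<Psi>\<close> compete in the distance from
  \<open>\<Phi>\<close> to \<open>\<Omega>\<close>, so Minkowski's inequality in \<open>L\<^sup>2\<close> applies. At distance 0 the attained minimum gives
  one function that is a factor of both densities.

  Two analytic points remain. Square roots of positive definite matrices must exist; they come from
  a contraction on Hermitian matrices (\<open>coercive_sqrt_exists\<close>). The closest factor must be
  measurable, which holds because the square root and the inverse are continuous on the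
  positive definite matrices (\<open>continuous_on_msqrt_pos_def\<close>,
  \<open>continuous_on_matrix_inv_pos_def\<close>). Traces are handled throughout as Frobenius inner products:
  the norm of the type of matrices is the Frobenius norm, and multiplication by a matrix has
  multiplication by its conjugate transpose as adjoint.
\<close>

section \<open>Matrix algebra under the Frobenius inner product\<close>

lemma bounded_bilinear_matrix_mult:
  "bounded_bilinear ((**) :: complex^'n^'n \<Rightarrow> complex^'n^'n \<Rightarrow> complex^'n^'n)"
proof -
  have "bilinear ((**) :: complex^'n^'n \<Rightarrow> complex^'n^'n \<Rightarrow> complex^'n^'n)"
    unfolding bilinear_def
    by (auto intro!: linearI simp: matrix_add_ldistrib matrix_scalar_ac scalar_matrix_assoc [symmetric])
       (vector matrix_matrix_mult_def sum.distrib [symmetric] field_simps)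
  then show ?thesis
    by (simp add: bilinear_conv_bounded_bilinear)
qed

interpretation matmul: bounded_bilinear "(**) :: complex^'n^'n \<Rightarrow> complex^'n^'n \<Rightarrow> complex^'n^'n"
  by (rule bounded_bilinear_matrix_mult)

lemma ctranspose_ctranspose [simp]: "ctranspose (ctranspose A) = A"
  by (simp add: ctranspose_def vec_eq_iff)

lemma ctranspose_mult: "ctranspose (A ** B) = ctranspose B ** ctranspose A"
  by (simp add: ctranspose_def vec_eq_iff matrix_matrix_mult_def mult.commute)

lemma ctranspose_add: "ctranspose (A + B) = ctranspose A + ctranspose B"
  by (simp add: ctranspose_def vec_eq_iff)

lemma ctranspose_diff: "ctranspose (A - B) = ctranspose A - ctranspose B"
  by (simp add: ctranspose_def vec_eq_iff)

lemma ctranspose_scaleR: "ctranspose (c *\<^sub>R A) = c *\<^sub>R ctranspose A"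
  by (simp add: ctranspose_def vec_eq_iff)

lemma ctranspose_mat1 [simp]: "ctranspose (mat 1 :: complex^'n^'n) = mat 1"
  by (simp add: ctranspose_def vec_eq_iff mat_def)

lemma inner_ctranspose: "inner (ctranspose X) (ctranspose Y) = inner X Y"
proof -
  have "inner (ctranspose X) (ctranspose Y) = (\<Sum>i\<in>UNIV. \<Sum>j\<in>UNIV. inner (X $ j $ i) (Y $ j $ i))"
    by (simp add: inner_vec_def ctranspose_def inner_complex_def)
  also have "\<dots> = inner X Y"
    by (subst sum.swap) (simp add: inner_vec_def)
  finally show ?thesis .
qed

lemma norm_ctranspose: "norm (ctranspose X) = norm X"
  by (simp add: norm_eq_sqrt_inner inner_ctranspose)

lemma continuous_ctranspose: "continuous_on S ctranspose"
  unfolding ctranspose_def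
  by (intro continuous_intros)

text \<open>Left multiplication by \<open>A\<close> has the conjugate transpose as its adjoint; with its mirror image
  this replaces all manipulations of traces below.\<close>

lemma inner_mult_left:
  fixes A :: "complex^'n^'m" and Y :: "complex^'p^'n"
  shows "inner X (A ** Y) = inner (ctranspose A ** X) Y"
proof -
  have c: "inner x (a * y) = inner (cnj a * x) y" for a x y :: complex
    by (simp add: inner_complex_def algebra_simps)
  have "inner X (A ** Y) = (\<Sum>i\<in>UNIV. \<Sum>j\<in>UNIV. \<Sum>k\<in>UNIV. inner (cnj (A $ i $ k) * X $ i $ j) (Y $ k $ j))"
    by (simp add: inner_vec_def matrix_matrix_mult_def inner_sum_right c)
  also have "\<dots> = (\<Sum>i\<in>UNIV. \<Sum>k\<in>UNIV. \<Sum>j\<in>UNIV. inner (cnj (A $ i $ k) * X $ i $ j) (Y $ k $ j))"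
    by (intro sum.cong refl sum.swap)
  also have "\<dots> = (\<Sum>k\<in>UNIV. \<Sum>i\<in>UNIV. \<Sum>j\<in>UNIV. inner (cnj (A $ i $ k) * X $ i $ j) (Y $ k $ j))"
    by (rule sum.swap)
  also have "\<dots> = (\<Sum>k\<in>UNIV. \<Sum>j\<in>UNIV. \<Sum>i\<in>UNIV. inner (cnj (A $ i $ k) * X $ i $ j) (Y $ k $ j))"
    by (intro sum.cong refl sum.swap)
  also have "\<dots> = inner (ctranspose A ** X) Y"
    by (simp add: inner_vec_def matrix_matrix_mult_def inner_sum_left ctranspose_def)
  finally show ?thesis .
qed

lemma inner_mult_right:
  fixes A :: "complex^'n^'m" and Y :: "complex^'m^'p"
  shows "inner X (Y ** A) = inner (X ** ctranspose A) Y"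
proof -
  have "inner X (Y ** A) = inner (ctranspose X) (ctranspose A ** ctranspose Y)"
    by (metis inner_ctranspose ctranspose_mult)
  also have "\<dots> = inner (A ** ctranspose X) (ctranspose Y)"
    by (simp add: inner_mult_left)
  also have "\<dots> = inner (X ** ctranspose A) Y"
    by (metis inner_ctranspose ctranspose_mult ctranspose_ctranspose)
  finally show ?thesis .
qed

lemma trace_mult_ctranspose: "Re (trace (F ** ctranspose F)) = (norm F)\<^sup>2"
  by (simp add: power2_norm_eq_inner trace_def matrix_matrix_mult_def ctranspose_def
        inner_vec_def inner_complex_def)

lemma norm_eq_inner_gram: "(norm F)\<^sup>2 = inner (mat 1) (F ** ctranspose F)"
  by (simp add: inner_mult_right power2_norm_eq_inner)

section \<open>Positive definite matrices\<close>

text \<open>The quadratic form of \<open>A\<close> on vectors and the form \<open>X \<mapsto> \<langle>X, A X\<rangle>\<close> on square matrices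
  carry the same sign information: the latter is the sum of the former over the columns of \<open>X\<close>.\<close>

lemma inner_mult_eq_sum_quad_form:
  fixes A :: "complex^'n^'n" and X :: "complex^'p^'n"
  shows "inner X (A ** X) = (\<Sum>j\<in>UNIV. Re (quad_form A (column j X)))"
proof -
  have "inner X (A ** X) = (\<Sum>i\<in>UNIV. \<Sum>j\<in>UNIV. Re (cnj (X $ i $ j) * (A *v column j X) $ i))"
    by (simp add: inner_vec_def inner_complex_def matrix_matrix_mult_def matrix_vector_mult_def
        column_def)
  also have "\<dots> = (\<Sum>j\<in>UNIV. \<Sum>i\<in>UNIV. Re (cnj (X $ i $ j) * (A *v column j X) $ i))"
    by (rule sum.swap)
  also have "\<dots> = (\<Sum>j\<in>UNIV. Re (quad_form A (column j X)))"
    by (simp add: quad_form_def column_def)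
  finally show ?thesis .
qed

lemma inner_mult_constant_columns:
  fixes A :: "complex^'n^'n" and v :: "complex^'n"
  shows "inner (\<chi> i j. v $ i :: complex^'n^'n) (A ** (\<chi> i j. v $ i)) = CARD('n) * Re (quad_form A v)"
proof -
  have "column j (\<chi> i j. v $ i) = v" for j :: 'n
    by (simp add: column_def vec_eq_iff)
  then show ?thesis
    by (simp add: inner_mult_eq_sum_quad_form)
qed

lemma pos_semidef_iff:
  fixes A :: "complex^'n^'n"
  shows "pos_semidef A \<longleftrightarrow> ctranspose A = A \<and> (\<forall>X :: complex^'n^'n. 0 \<le> inner X (A ** X))"
proof -
  have "0 \<le> Re (quad_form A v)" if "\<forall>X :: complex^'n^'n. 0 \<le> inner X (A ** X)" for v
    using that[rule_format, of "\<chi> i j. v $ i"]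
    by (simp add: inner_mult_constant_columns zero_le_mult_iff)
  then show ?thesis
    by (auto simp: pos_semidef_def hermitian_def inner_mult_eq_sum_quad_form intro: sum_nonneg)
qed

lemma pos_def_iff:
  fixes A :: "complex^'n^'n"
  shows "pos_def A \<longleftrightarrow> ctranspose A = A \<and> (\<forall>X :: complex^'n^'n. X \<noteq> 0 \<longrightarrow> 0 < inner X (A ** X))"
proof -
  have *: "0 < Re (quad_form A v)"
    if "\<forall>X :: complex^'n^'n. X \<noteq> 0 \<longrightarrow> 0 < inner X (A ** X)" "v \<noteq> 0" for v
  proof -
    have "(\<chi> i j. v $ i :: complex^'n^'n) \<noteq> 0"
      using that(2) by (auto simp: vec_eq_iff)
    with that(1) have "0 < CARD('n) * Re (quad_form A v)"
      unfolding inner_mult_constant_columns [symmetric] by blast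
    then show ?thesis
      by (simp add: zero_less_mult_iff)
  qed
  have "0 < inner X (A ** X)"
    if A: "\<forall>v. v \<noteq> 0 \<longrightarrow> 0 < Re (quad_form A v)" and X: "X \<noteq> 0" for X :: "complex^'n^'n"
  proof -
    obtain j where "column j X \<noteq> 0"
      using X by (auto simp: column_def vec_eq_iff)
    moreover have "0 \<le> Re (quad_form A v)" for v
      using A by (cases "v = 0") (auto simp: quad_form_def less_imp_le)
    ultimately show ?thesis
      unfolding inner_mult_eq_sum_quad_form
      using A by (intro sum_pos2[of _ j]) auto
  qed
  with * show ?thesis
    by (auto simp: pos_def_def hermitian_def)
qed

text \<open>A lower bound on the form that is uniform in \<open>X\<close>, as needed for estimates; for \<open>c > 0\<close> it is a
  quantitative form of positive definiteness.\<close>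

definition coercive :: "real \<Rightarrow> complex^'n^'n \<Rightarrow> bool" where
  "coercive c A \<longleftrightarrow> ctranspose A = A \<and> (\<forall>X :: complex^'n^'n. c * (norm X)\<^sup>2 \<le> inner X (A ** X))"

lemma coercive_imp_pos_def:
  assumes "coercive c A" "0 < c"
  shows "pos_def A"
  using assms by (auto simp: coercive_def pos_def_iff)
    (metis less_le_trans mult_pos_pos zero_less_norm_iff zero_less_power)

lemma pos_def_imp_pos_semidef: "pos_def A \<Longrightarrow> pos_semidef A"
  by (auto simp: pos_def_iff pos_semidef_iff)
    (metis inner_zero_left less_imp_le order_refl)

text \<open>The form of a positive definite matrix attains its minimum on the compact unit sphere.\<close>

lemma pos_def_imp_coercive:
  fixes A :: "complex^'n^'n"
  assumes "pos_def A"
  obtains c where "0 < c" "coercive c A"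
proof -
  let ?q = "\<lambda>X :: complex^'n^'n. inner X (A ** X)"
  have "continuous_on (sphere 0 1) ?q"
    by (intro continuous_intros matmul.continuous_on)
  moreover have "compact (sphere 0 1 :: (complex^'n^'n) set)" "sphere 0 1 \<noteq> ({} :: (complex^'n^'n) set)"
    by auto
  ultimately obtain X0 where X0: "X0 \<in> sphere 0 1" "\<And>X. X \<in> sphere 0 1 \<Longrightarrow> ?q X0 \<le> ?q X"
    using continuous_attains_inf[of "sphere 0 1" ?q] by blast
  have "?q X0 * (norm X)\<^sup>2 \<le> ?q X" for X
  proof (cases "X = 0")
    case False
    then have "?q X0 \<le> ?q ((1 / norm X) *\<^sub>R X)"
      by (intro X0(2)) simp
    also have "\<dots> = ?q X / (norm X)\<^sup>2"
      by (simp add: matmul.scaleR_right power2_eq_square)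
    finally show ?thesis
      using False by (simp add: field_simps)
  qed simp
  moreover have "0 < ?q X0"
  proof -
    have "X0 \<noteq> 0"
      using X0(1) by auto
    with assms show ?thesis
      by (simp add: pos_def_iff)
  qed
  ultimately show thesis
    using assms that by (auto simp: coercive_def pos_def_iff)
qed

lemma coercive_norm_mult:
  fixes A X :: "complex^'n^'n"
  assumes "coercive c A"
  shows "c * norm X \<le> norm (A ** X)"
proof (cases "X = 0")
  case False
  have "c * (norm X)\<^sup>2 \<le> norm X * norm (A ** X)"
    using assms norm_cauchy_schwarz[of X "A ** X"] unfolding coercive_def by (blast intro: order_trans)
  with False show ?thesis
    by (simp add: power2_eq_square mult.left_commute)
qed simp

lemma pos_def_congruence:
  fixes A C :: "complex^'n^'n"
  assumes A: "pos_def A" and C: "C' ** C = mat 1"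
  shows "pos_def (ctranspose C ** A ** C)"
proof -
  have "C ** X \<noteq> 0" if "X \<noteq> 0" for X :: "complex^'n^'n"
    using that C by (metis matrix_mul_assoc matrix_mul_lid times0_right)
  moreover have "inner X ((ctranspose C ** A ** C) ** X) = inner (C ** X) (A ** (C ** X))"
    for X :: "complex^'n^'n"
    using inner_mult_left[of X "ctranspose C" "A ** (C ** X)"] by (simp add: matrix_mul_assoc)
  moreover have "ctranspose (ctranspose C ** A ** C) = ctranspose C ** A ** C"
    using A by (simp add: pos_def_iff ctranspose_mult matrix_mul_assoc)
  ultimately show ?thesis
    using A unfolding pos_def_iff by presburger
qed

section \<open>Inverses and square roots of positive definite matrices\<close>

lemma invertible_matrix_inv:
  assumes "invertible A"
  shows "A ** matrix_inv A = mat 1" "matrix_inv A ** A = mat 1"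
  using someI_ex[of "\<lambda>A'. A ** A' = mat 1 \<and> A' ** A = mat 1"] assms
  unfolding invertible_def matrix_inv_def by auto

lemma pos_def_invertible:
  fixes A :: "complex^'n^'n"
  assumes "pos_def A"
  shows "invertible A"
proof -
  have inj: "inj ((**) A :: complex^'n^'n \<Rightarrow> complex^'n^'n)"
  proof (rule linear_injective_0[THEN iffD2, rule_format])
    show "linear ((**) A :: complex^'n^'n \<Rightarrow> complex^'n^'n)"
      by (rule bounded_linear.linear[OF matmul.bounded_linear_right])
    show "X = 0" if "A ** X = 0" for X :: "complex^'n^'n"
      using that assms unfolding pos_def_iff by (metis inner_zero_right less_irrefl)
  qed
  have "surj ((**) A :: complex^'n^'n \<Rightarrow> complex^'n^'n)"
    by (rule linear_injective_imp_surjective[OF bounded_linear.linear[OF matmul.bounded_linear_right] inj]) simp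
  then obtain B where "A ** B = mat 1"
    by (metis surjD)
  then show ?thesis
    unfolding invertible_right_inverse by blast
qed

lemma pos_def_inverse:
  fixes A :: "complex^'n^'n"
  assumes "pos_def A"
  shows "A ** matrix_inv A = mat 1" "matrix_inv A ** A = mat 1"
    "ctranspose (matrix_inv A) = matrix_inv A"
proof -
  show 1: "A ** matrix_inv A = mat 1" and 2: "matrix_inv A ** A = mat 1"
    using invertible_matrix_inv[OF pos_def_invertible[OF assms]] .
  have "ctranspose (matrix_inv A) ** A = mat 1"
    using 1 assms by (metis ctranspose_mult ctranspose_mat1 pos_def_iff)
  then show "ctranspose (matrix_inv A) = matrix_inv A"
    by (metis 1 matrix_mul_assoc matrix_mul_lid matrix_mul_rid)
qed

text \<open>Inverses stay bounded near \<open>R\<close>: if \<open>\<parallel>R X\<parallel> \<ge> c \<parallel>X\<parallel>\<close>, then \<open>\<parallel>R' X\<parallel> \<ge> (c - K \<parallel>R' - R\<parallel>) \<parallel>X\<parallel>\<close>, where \<open>K\<close>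
  bounds matrix multiplication. Take \<open>X = R'\<^sup>-\<^sup>1 - R\<^sup>-\<^sup>1\<close>, for which \<open>R' X = (R - R') R\<^sup>-\<^sup>1\<close>
  tends to 0.\<close>

lemma continuous_on_matrix_inv_pos_def:
  "continuous_on {R :: complex^'n^'n. pos_def R} matrix_inv"
  unfolding continuous_on_def
proof safe
  fix R :: "complex^'n^'n"
  assume R: "pos_def R"
  let ?F = "at R within {R. pos_def R}"
  obtain c where c: "0 < c" "coercive c R"
    using pos_def_imp_coercive[OF R] .
  obtain K where K: "0 < K" "\<And>X Y. norm (X ** Y :: complex^'n^'n) \<le> norm (X :: complex^'n^'n) * norm (Y :: complex^'n^'n) * K"
    using matmul.pos_bounded[where 'n = 'n] by auto
  have key: "norm (matrix_inv R' - matrix_inv R) * (c / 2) \<le> norm (R' - R) * (K * norm (matrix_inv R))"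
    if R': "pos_def R'" "norm (R' - R) * K \<le> c / 2" for R'
  proof -
    let ?D = "matrix_inv R' - matrix_inv R"
    have "R' ** ?D = (R - R') ** matrix_inv R"
      by (simp add: matmul.diff_left matmul.diff_right pos_def_inverse R R')
    then have "norm (R' ** ?D) \<le> norm (R' - R) * norm (matrix_inv R) * K"
      using K(2)[of "R - R'" "matrix_inv R"] by (simp add: norm_minus_commute)
    moreover have "norm (R ** ?D) \<le> norm (R' ** ?D) + norm ((R' - R) ** ?D)"
      using norm_triangle_ineq4[of "R' ** ?D" "(R' - R) ** ?D"] by (simp add: matmul.diff_left)
    moreover have "norm ((R' - R) ** ?D) \<le> (norm (R' - R) * K) * norm ?D"
      using K(2)[of "R' - R" ?D] by (simp add: mult_ac)
    moreover have "(norm (R' - R) * K) * norm ?D \<le> c / 2 * norm ?D"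
      using R'(2) by (rule mult_right_mono) simp
    moreover have "c * norm ?D \<le> norm (R ** ?D)"
      using c(2) by (rule coercive_norm_mult)
    ultimately show ?thesis
      by (simp add: mult_ac)
  qed
  have lim: "((\<lambda>R'. norm (R' - R)) \<longlongrightarrow> 0) ?F"
    by (intro tendsto_norm_zero LIM_zero tendsto_ident_at)
  have "\<forall>\<^sub>F R' in ?F. norm (R' - R) < c / 2 / K"
    by (rule order_tendstoD(2)[OF lim]) (use c K in simp)
  moreover have "\<forall>\<^sub>F R' in ?F. pos_def R'"
    by (simp add: eventually_at_filter)
  ultimately have ev: "\<forall>\<^sub>F R' in ?F. norm (matrix_inv R' - matrix_inv R)
      \<le> norm (norm (R' - R)) * (K * norm (matrix_inv R) / (c / 2))"
  proof eventually_elim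
    case (elim R')
    then have "norm (matrix_inv R' - matrix_inv R) * (c / 2) \<le> norm (R' - R) * (K * norm (matrix_inv R))"
      by (intro key) (use K in \<open>simp_all add: field_simps\<close>)
    then show ?case
      using c(1) by (simp add: field_simps)
  qed
  have "((\<lambda>R'. matrix_inv R' - matrix_inv R) \<longlongrightarrow> 0) ?F"
    by (rule tendsto_0_le[OF lim ev])
  then show "(matrix_inv \<longlongrightarrow> matrix_inv R) ?F"
    by (simp add: LIM_zero_iff)
qed

text \<open>A Hermitian matrix whose form is bounded by \<open>r\<close> has operator norm at most \<open>r\<close>: polarise the
  form and balance the lengths of the two arguments.\<close>

lemma norm_mult_le_of_form_bound:
  fixes X Y :: "complex^'n^'n"
  assumes Y: "ctranspose Y = Y" and r: "\<And>X :: complex^'n^'n. \<bar>inner X (Y ** X)\<bar> \<le> r * (norm X)\<^sup>2"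
  shows "norm (Y ** X) \<le> r * norm X"
proof (cases "Y ** X = 0")
  case True
  show ?thesis
  proof (cases "X = 0")
    case False
    have "0 \<le> r * (norm X)\<^sup>2"
      using r[of X] by linarith
    with False True show ?thesis
      by (simp add: zero_le_mult_iff)
  qed simp
next
  case False
  then have "X \<noteq> 0"
    by auto
  \<comment> \<open>\<open>Z\<close> points in the direction of \<open>Y X\<close> and has the length of \<open>X\<close>.\<close>
  define t where "t = norm X / norm (Y ** X)"
  define Z where "Z = t *\<^sub>R (Y ** X)"
  have nZ: "norm Z = norm X"
    using False by (simp add: Z_def t_def)
  have comm: "inner X (Y ** Z) = inner Z (Y ** X)"
    using inner_mult_left[of X Y Z] Y by (simp add: inner_commute)
  have "4 * inner Z (Y ** X) = inner (X + Z) (Y ** (X + Z)) - inner (X - Z) (Y ** (X - Z))"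
    by (simp add: matmul.add_right matmul.diff_right inner_add_left inner_add_right
        inner_diff_left inner_diff_right comm)
  also have "\<dots> \<le> r * (norm (X + Z))\<^sup>2 + r * (norm (X - Z))\<^sup>2"
    using r[of "X + Z"] r[of "X - Z"] by linarith
  also have "\<dots> = 2 * r * ((norm X)\<^sup>2 + (norm Z)\<^sup>2)"
    by (simp add: power2_norm_eq_inner inner_add_left inner_add_right inner_diff_left
        inner_diff_right inner_commute algebra_simps)
  also have "\<dots> = 4 * r * (norm X)\<^sup>2"
    by (simp add: nZ)
  finally have "t * (norm (Y ** X))\<^sup>2 \<le> r * (norm X)\<^sup>2"
    by (simp add: Z_def power2_norm_eq_inner)
  then have "norm X * norm (Y ** X) \<le> norm X * (r * norm X)"
    using False by (simp add: t_def power2_eq_square mult_ac)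
  with \<open>X \<noteq> 0\<close> show ?thesis
    by simp
qed

text \<open>For \<open>K\<close> large, the form of \<open>A / K\<close> lies between \<open>c / K\<close> and 1, so \<open>A = K (1 - B)\<close> with
  \<open>0 \<le> B \<le> 1 - c / K\<close>. Then \<open>\<surd>K (1 - Y)\<close> squares to \<open>A\<close> as soon as \<open>Y = (B + Y\<^sup>2) / 2\<close>. The
  right-hand side of this equation maps the Hermitian matrices of operator norm at most
  \<open>r = 1 - \<surd>(c / K)\<close> to themselves, because \<open>(1 - c / K) + r\<^sup>2 = 2 r\<close>, and is a contraction there with
  constant \<open>r\<close>, because \<open>Y\<^sup>2 - Z\<^sup>2 = Y (Y - Z) + (Y - Z) Z\<close>. The bound \<open>r < 1\<close> also makes the
  root coercive.\<close>

lemma coercive_sqrt_exists: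
  fixes A :: "complex^'n^'n"
  assumes c: "0 < c" and A: "coercive c A"
  obtains s S where "0 < s" "coercive s S" "S ** S = A"
proof -
  obtain K0 where K0: "0 < K0" "\<And>X Y. norm (X ** Y :: complex^'n^'n) \<le> norm (X :: complex^'n^'n) * norm (Y :: complex^'n^'n) * K0"
    using matmul.pos_bounded[where 'n = 'n] by auto
  define K where "K = norm A * K0 + c"
  have K: "0 < K" "c \<le> K"
    using c K0(1) by (simp_all add: K_def add_nonneg_pos)
  have upper: "inner X (A ** X) \<le> K * (norm X)\<^sup>2" for X :: "complex^'n^'n"
  proof -
    have "inner X (A ** X) \<le> norm X * norm (A ** X)"
      by (rule norm_cauchy_schwarz)
    also have "\<dots> \<le> norm X * (norm A * norm X * K0)"
      by (intro mult_left_mono K0(2)) simp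
    also have "\<dots> \<le> K * (norm X)\<^sup>2"
      using c by (simp add: K_def power2_eq_square algebra_simps)
    finally show ?thesis .
  qed
  define r where "r = 1 - sqrt (c / K)"
  have r: "0 \<le> r" "r < 1"
    using c K by (simp_all add: r_def)
  define B where "B = mat 1 - (1 / K) *\<^sub>R A"
  have herm_B: "ctranspose B = B"
    using A by (simp add: B_def coercive_def ctranspose_diff ctranspose_scaleR)
  have form_B: "inner X (B ** X) = (norm X)\<^sup>2 - inner X (A ** X) / K" for X :: "complex^'n^'n"
    by (simp add: B_def matmul.diff_left matmul.scaleR_left inner_diff_right power2_norm_eq_inner)
  have "\<bar>inner X (B ** X)\<bar> \<le> (1 - c / K) * (norm X)\<^sup>2" for X :: "complex^'n^'n"
  proof -
    have "c * (norm X)\<^sup>2 \<le> inner X (A ** X)"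
      using A by (simp add: coercive_def)
    with upper[of X] K(1) show ?thesis
      unfolding form_B by (simp add: field_simps abs_le_iff)
  qed
  then have B: "norm (B ** X) \<le> (1 - c / K) * norm X" for X :: "complex^'n^'n"
    by (rule norm_mult_le_of_form_bound[OF herm_B])
  define \<Y> where "\<Y> = {Y :: complex^'n^'n. ctranspose Y = Y \<and> (\<forall>X :: complex^'n^'n. norm (Y ** X) \<le> r * norm X)}"
  define f where "f = (\<lambda>Y. (1 / 2) *\<^sub>R (B + Y ** Y))"
  have "closed \<Y>"
    unfolding \<Y>_def
    by (intro closed_Collect_conj closed_Collect_all closed_Collect_eq closed_Collect_le
        continuous_ctranspose continuous_intros matmul.continuous_on)
  then have "complete \<Y>"
    by (simp add: complete_eq_closed)
  moreover have "0 \<in> \<Y>"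
    using r by (simp add: \<Y>_def ctranspose_def vec_eq_iff)
  moreover have "f Y \<in> \<Y>" if Y: "Y \<in> \<Y>" for Y
  proof -
    have "norm (f Y ** X) \<le> r * norm X" for X :: "complex^'n^'n"
    proof -
      have "norm (Y ** (Y ** X)) \<le> r * norm (Y ** X)"
        using Y by (simp add: \<Y>_def)
      also have "\<dots> \<le> r * (r * norm X)"
        using Y r by (intro mult_left_mono) (auto simp: \<Y>_def)
      finally have "norm (B ** X + Y ** (Y ** X)) \<le> (1 - c / K) * norm X + r * (r * norm X)"
        using B[of X] norm_triangle_ineq[of "B ** X" "Y ** (Y ** X)"] by linarith
      also have "\<dots> = ((1 - c / K) + r\<^sup>2) * norm X"
        by (simp add: algebra_simps power2_eq_square)
      also have "(1 - c / K) + r\<^sup>2 = 2 * r"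
        using c K by (simp add: r_def power2_diff)
      finally show ?thesis
        by (simp add: f_def matmul.scaleR_left matmul.add_left matrix_mul_assoc)
    qed
    with Y show ?thesis
      by (simp add: \<Y>_def f_def ctranspose_add ctranspose_scaleR ctranspose_mult herm_B)
  qed
  moreover have "dist (f Y) (f Z) \<le> r * dist Y Z" if YZ: "Y \<in> \<Y>" "Z \<in> \<Y>" for Y Z
  proof -
    \<comment> \<open>The bound on \<open>Z\<close> concerns multiplication from the left; transposing moves \<open>Z\<close> there.\<close>
    have "norm ((Y - Z) ** Z) = norm (Z ** ctranspose (Y - Z))"
      using YZ(2) norm_ctranspose[of "(Y - Z) ** Z"] by (simp add: ctranspose_mult \<Y>_def)
    also have "\<dots> \<le> r * norm (ctranspose (Y - Z))"
      using YZ(2) unfolding \<Y>_def by blast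
    also have "\<dots> = r * norm (Y - Z)"
      by (simp add: norm_ctranspose)
    finally have "norm ((Y - Z) ** Z) \<le> r * norm (Y - Z)" .
    moreover have "norm (Y ** (Y - Z)) \<le> r * norm (Y - Z)"
      using YZ(1) by (simp add: \<Y>_def)
    moreover have "f Y - f Z = (1 / 2) *\<^sub>R (Y ** (Y - Z) + (Y - Z) ** Z)"
      by (simp add: f_def matmul.diff_left matmul.diff_right scaleR_diff_right [symmetric])
    ultimately show ?thesis
      using norm_triangle_ineq[of "Y ** (Y - Z)" "(Y - Z) ** Z"] by (simp add: dist_norm)
  qed
  ultimately have "\<exists>!Y\<in>\<Y>. f Y = Y"
    using r by (intro Banach_fix[where c = r]) auto
  then obtain Y where Y: "Y \<in> \<Y>" "f Y = Y"
    by blast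
  have Y2: "Y ** Y = 2 *\<^sub>R Y - B"
  proof -
    have "2 *\<^sub>R Y = 2 *\<^sub>R f Y"
      by (simp add: Y(2))
    also have "\<dots> = B + Y ** Y"
      by (simp add: f_def)
    finally show ?thesis
      by simp
  qed
  define S where "S = sqrt K *\<^sub>R (mat 1 - Y)"
  have "S ** S = K *\<^sub>R (mat 1 - B)"
    using K(1)
    by (simp add: S_def matmul.scaleR_left matmul.scaleR_right matmul.diff_left matmul.diff_right Y2
        algebra_simps scaleR_2)
  also have "\<dots> = A"
    using K(1) by (simp add: B_def)
  finally have "S ** S = A" .
  moreover have "coercive (sqrt K * (1 - r)) S"
    unfolding coercive_def
  proof safe
    show "ctranspose S = S"
      using Y(1) by (simp add: S_def \<Y>_def ctranspose_scaleR ctranspose_diff)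
    fix X :: "complex^'n^'n"
    have "inner X (Y ** X) \<le> norm X * norm (Y ** X)"
      by (rule norm_cauchy_schwarz)
    also have "\<dots> \<le> norm X * (r * norm X)"
      using Y(1) by (intro mult_left_mono) (auto simp: \<Y>_def)
    finally have "(1 - r) * (norm X)\<^sup>2 \<le> (norm X)\<^sup>2 - inner X (Y ** X)"
      by (simp add: power2_eq_square algebra_simps)
    then have "sqrt K * ((1 - r) * (norm X)\<^sup>2) \<le> sqrt K * ((norm X)\<^sup>2 - inner X (Y ** X))"
      using K(1) by (intro mult_left_mono) auto
    then show "sqrt K * (1 - r) * (norm X)\<^sup>2 \<le> inner X (S ** X)"
      by (simp add: S_def matmul.scaleR_left matmul.diff_left inner_diff_right power2_norm_eq_inner mult_ac)
  qed
  moreover have "0 < sqrt K * (1 - r)"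
    using K r by simp
  ultimately show thesis
    using that by blast
qed

text \<open>With \<open>D = S' - S\<close>, the identity \<open>S'\<^sup>2 - S\<^sup>2 = S' D + D S\<close> gives
  \<open>\<langle>D, S'\<^sup>2 - S\<^sup>2\<rangle> = \<langle>D, S' D\<rangle> + \<langle>D, D S\<rangle>\<close>, in which the first term is non-negative and
  the second is at least \<open>s \<parallel>D\<parallel>\<^sup>2\<close>. This yields uniqueness and continuity of the square root at once.\<close>

lemma sqrt_stability:
  fixes S S' :: "complex^'n^'n"
  assumes S: "coercive s S" and S': "pos_semidef S'"
  shows "s * norm (S' - S) \<le> norm (S' ** S' - S ** S)"
proof (cases "S' - S = 0")
  case False
  let ?D = "S' - S"
  have herm: "ctranspose S = S" "ctranspose S' = S'"
    using S S' by (auto simp: coercive_def pos_semidef_iff)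
  have "s * (norm ?D)\<^sup>2 \<le> inner ?D (S ** ?D)"
    using S by (simp add: coercive_def)
  also have "\<dots> = inner ?D (?D ** S)"
    using inner_ctranspose[of ?D "?D ** S"] by (simp add: ctranspose_mult ctranspose_diff herm)
  also have "\<dots> \<le> inner ?D (S' ** ?D) + inner ?D (?D ** S)"
    using S' by (simp add: pos_semidef_iff)
  also have "\<dots> = inner ?D (S' ** S' - S ** S)"
    by (simp add: inner_add_right [symmetric] matmul.diff_left matmul.diff_right)
  also have "\<dots> \<le> norm ?D * norm (S' ** S' - S ** S)"
    by (rule norm_cauchy_schwarz)
  finally show ?thesis
    using False by (simp add: power2_eq_square mult.left_commute)
qed simp

text \<open>The defining description of \<^const>\<open>msqrt\<close> asks for uniqueness among all positive semidefinite
  roots. One positive definite root is enough for that: stability at it rules out the others.\<close>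

lemma msqrt_eqI:
  assumes "pos_def S" "S ** S = A"
  shows "msqrt A = S"
  unfolding msqrt_def
proof (rule the_equality)
  show "pos_semidef S \<and> S ** S = A"
    using assms pos_def_imp_pos_semidef by auto
  obtain s where s: "0 < s" "coercive s S"
    using pos_def_imp_coercive[OF assms(1)] .
  show "T = S" if "pos_semidef T \<and> T ** T = A" for T
    using sqrt_stability[OF s(2), of T] that s(1) assms(2) by (simp add: mult_le_0_iff)
qed

lemma msqrt_pos_def:
  assumes "pos_def A"
  shows "pos_def (msqrt A)" "msqrt A ** msqrt A = A"
proof -
  obtain c where "0 < c" "coercive c A"
    using pos_def_imp_coercive[OF assms] .
  then obtain s S where S: "0 < s" "coercive s S" "S ** S = A"
    by (rule coercive_sqrt_exists)
  have "msqrt A = S"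
    using S by (intro msqrt_eqI coercive_imp_pos_def)
  with S show "pos_def (msqrt A)" "msqrt A ** msqrt A = A"
    using coercive_imp_pos_def by auto
qed

lemma continuous_on_msqrt_pos_def:
  "continuous_on {A :: complex^'n^'n. pos_def A} msqrt"
  unfolding continuous_on_def
proof safe
  fix A :: "complex^'n^'n"
  assume A: "pos_def A"
  let ?F = "at A within {A. pos_def A}"
  obtain s where s: "0 < s" "coercive s (msqrt A)"
    using pos_def_imp_coercive[OF msqrt_pos_def(1)[OF A]] .
  have lim: "((\<lambda>A'. A' - A) \<longlongrightarrow> 0) ?F"
    by (rule LIM_zero) (rule tendsto_ident_at)
  have "\<forall>\<^sub>F A' in ?F. pos_def A'"
    by (simp add: eventually_at_filter)
  then have ev: "\<forall>\<^sub>F A' in ?F. norm (msqrt A' - msqrt A) \<le> norm (A' - A) * (1 / s)"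
  proof eventually_elim
    case (elim A')
    then have "s * norm (msqrt A' - msqrt A) \<le> norm (A' - A)"
      using sqrt_stability[OF s(2), of "msqrt A'"] A
      by (simp add: msqrt_pos_def pos_def_imp_pos_semidef)
    then show ?case
      using s(1) by (simp add: field_simps)
  qed
  have "((\<lambda>A'. msqrt A' - msqrt A) \<longlongrightarrow> 0) ?F"
    by (rule tendsto_0_le[OF lim ev])
  then show "(msqrt \<longlongrightarrow> msqrt A) ?F"
    by (simp add: LIM_zero_iff)
qed

section \<open>The optimal transport matrix\<close>

text \<open>The linear map that transports the centred Gaussian law with covariance \<open>B\<close> optimally to the one with
  covariance \<open>A\<close>. It is the positive definite solution of \<open>T B T = A\<close>.\<close>

definition transport :: "complex^'n^'n \<Rightarrow> complex^'n^'n \<Rightarrow> complex^'n^'n" where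
  "transport A B = msqrt A ** matrix_inv (msqrt (msqrt A ** B ** msqrt A)) ** msqrt A"

lemma W_hat_eq_transport: "W_hat \<Phi> \<Psi> W = (\<lambda>z. transport (\<Phi> z) (\<Psi> z) ** W z)"
  by (simp add: fun_eq_iff W_hat_def transport_def)

lemma matrix_cancel: "P ** Q = mat 1 \<Longrightarrow> P ** (Q ** Z) = (Z :: complex^'n^'n)"
  by (simp add: matrix_mul_assoc)

lemma pos_def_sandwich:
  fixes A B :: "complex^'n^'n"
  assumes "pos_def A" "pos_def B"
  shows "pos_def (msqrt A ** B ** msqrt A)"
  using pos_def_congruence[OF assms(2) pos_def_inverse(2)[OF msqrt_pos_def(1)[OF assms(1)]]]
    msqrt_pos_def(1)[OF assms(1)]
  by (simp add: pos_def_iff)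

text \<open>Write \<open>S = A\<^sup>1\<^sup>/\<^sup>2\<close> and \<open>R = (S B S)\<^sup>1\<^sup>/\<^sup>2\<close>, so that \<open>T = S R\<^sup>-\<^sup>1 S\<close>. Then
  \<open>T B T = S R\<^sup>-\<^sup>1 R\<^sup>2 R\<^sup>-\<^sup>1 S = A\<close>, and \<open>G = S\<^sup>-\<^sup>1 R S\<^sup>-\<^sup>1\<close> is an inverse of \<open>T\<close> that is positive definite
  as a congruence of \<open>R\<close>.\<close>

lemma transport_properties:
  fixes A B :: "complex^'n^'n"
  assumes A: "pos_def A" and B: "pos_def B"
  obtains G where "pos_def G" "G ** transport A B = mat 1" "transport A B ** G = mat 1"
    "ctranspose (transport A B) = transport A B" "transport A B ** B ** transport A B = A"
proof -
  define S where "S = msqrt A"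
  define R where "R = msqrt (S ** B ** S)"
  define S' where "S' = matrix_inv S"
  define Q where "Q = matrix_inv R"
  have T: "transport A B = S ** Q ** S"
    by (simp add: transport_def S_def R_def Q_def)
  have M: "pos_def (S ** B ** S)"
    unfolding S_def using A B by (rule pos_def_sandwich)
  have S: "pos_def S" "S ** S = A" and R: "pos_def R" "R ** R = S ** (B ** S)"
    using msqrt_pos_def[OF A] msqrt_pos_def[OF M] by (simp_all add: S_def R_def matrix_mul_assoc)
  note inv = pos_def_inverse[OF S(1), folded S'_def] pos_def_inverse[OF R(1), folded Q_def]
  note cancel = inv(1,2,4,5) inv(1,2,4,5)[THEN matrix_cancel]
  have herm: "ctranspose S = S" "ctranspose R = R"
    using S(1) R(1) by (auto simp: pos_def_iff)
  have "pos_def (ctranspose S' ** R ** S')"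
    by (rule pos_def_congruence[OF R(1) inv(1)])
  then have "pos_def (S' ** R ** S')"
    by (simp add: inv)
  moreover have "(S' ** R ** S') ** transport A B = mat 1" "transport A B ** (S' ** R ** S') = mat 1"
    by (simp_all add: T matrix_mul_assoc [symmetric] cancel)
  moreover have "ctranspose (transport A B) = transport A B"
    by (simp add: T ctranspose_mult herm inv matrix_mul_assoc)
  moreover have "transport A B ** B ** transport A B = A"
  proof -
    have "transport A B ** B ** transport A B = S ** (Q ** ((S ** (B ** S)) ** (Q ** S)))"
      by (simp add: T matrix_mul_assoc)
    also have "\<dots> = A"
      by (simp add: R(2) [symmetric] matrix_mul_assoc [symmetric] cancel S(2))
    finally show ?thesis .
  qed
  ultimately show thesis
    using that by blast
qed

lemma transport_factor:
  fixes A B V :: "complex^'n^'n"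
  assumes "pos_def A" "pos_def B" "V ** ctranspose V = B"
  shows "(transport A B ** V) ** ctranspose (transport A B ** V) = A"
proof -
  have "ctranspose (transport A B) = transport A B" "transport A B ** B ** transport A B = A"
    using transport_properties[OF assms(1,2)] by blast+
  then show ?thesis
    by (simp add: ctranspose_mult assms(3) [symmetric] matrix_mul_assoc)
qed

text \<open>By the next lemma this is the squared distance from any factor \<open>V\<close> of \<open>B\<close> to \<open>T V\<close>. The formula
  does not involve \<open>V\<close>, which is why every factor of \<open>B\<close> lies equally close to the factors of \<open>A\<close>.\<close>

definition transport_cost :: "complex^'n^'n \<Rightarrow> complex^'n^'n \<Rightarrow> real" where
  "transport_cost A B = inner (mat 1) A + inner (mat 1) B - 2 * inner (transport A B) B"

lemma norm_diff_transport:
  fixes A B V :: "complex^'n^'n"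
  assumes A: "pos_def A" and B: "pos_def B" and V: "V ** ctranspose V = B"
  shows "(norm (V - transport A B ** V))\<^sup>2 = transport_cost A B"
proof -
  let ?T = "transport A B"
  have "(norm (V - ?T ** V))\<^sup>2 = (norm V)\<^sup>2 + (norm (?T ** V))\<^sup>2 - 2 * inner (?T ** V) V"
    by (simp add: power2_norm_eq_inner inner_diff_left inner_diff_right inner_commute)
  also have "(norm V)\<^sup>2 = inner (mat 1) B"
    by (simp add: norm_eq_inner_gram V)
  also have "(norm (?T ** V))\<^sup>2 = inner (mat 1) A"
    by (simp only: norm_eq_inner_gram transport_factor[OF assms])
  also have "inner (?T ** V) V = inner ?T B"
    using inner_mult_right[of "?T" V "ctranspose V"] V by simp
  finally show ?thesis
    by (simp add: transport_cost_def)
qed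

text \<open>Completing the square. With \<open>G = T\<^sup>-\<^sup>1\<close>, expanding the form of \<open>G\<close> at \<open>W - T V\<close> gives
  \<open>\<langle>W, G W\<rangle> - 2 \<langle>V, W\<rangle> + \<langle>V, T V\<rangle>\<close>, and \<open>G A = B T\<close> shows that the first term is \<open>\<langle>T, B\<rangle>\<close>, like the
  last one. Both sides therefore equal \<open>2 \<langle>T, B\<rangle> - 2 \<langle>V, W\<rangle>\<close>. The inequality and the equality case
  below are positivity and definiteness of \<open>G\<close>.\<close>

lemma transport_gap:
  fixes A B V :: "complex^'n^'n"
  assumes A: "pos_def A" and B: "pos_def B" and V: "V ** ctranspose V = B"
  obtains G where "pos_def G"
    "\<And>W. W ** ctranspose W = A \<Longrightarrow> (norm (V - W))\<^sup>2 - transport_cost A B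
       = inner (W - transport A B ** V) (G ** (W - transport A B ** V))"
proof -
  let ?T = "transport A B"
  obtain G where G: "pos_def G" "G ** ?T = mat 1" "?T ** G = mat 1"
    and T: "ctranspose ?T = ?T" "?T ** B ** ?T = A"
    using transport_properties[OF A B] .
  have herm: "ctranspose G = G"
    using G(1) by (simp add: pos_def_iff)
  have "(norm (V - W))\<^sup>2 - transport_cost A B
       = inner (W - ?T ** V) (G ** (W - ?T ** V))" if W: "W ** ctranspose W = A" for W
  proof -
    have GA: "G ** A = B ** ?T"
    proof -
      have "G ** (?T ** B ** ?T) = B ** ?T"
        by (simp add: matrix_mul_assoc [symmetric] matrix_cancel[OF G(2)])
      then show ?thesis
        by (simp only: T(2))
    qed
    have TB: "inner (?T ** V) V = inner ?T B"
      using inner_mult_right[of "?T" V "ctranspose V"] V by simp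
    have "inner W (G ** W) = inner G A"
      using inner_mult_right[of G W "ctranspose W"] W by (simp add: inner_commute[of W "G ** W"])
    also have "\<dots> = inner (mat 1) (G ** A)"
      using inner_mult_left[of "mat 1" G A] herm by simp
    also have "\<dots> = inner ?T B"
      using inner_mult_right[of "mat 1" B ?T] T(1) by (simp add: GA)
    finally have 1: "inner W (G ** W) = inner ?T B" .
    have 2: "G ** (?T ** V) = V"
      by (simp add: matrix_cancel[OF G(2)])
    have 3: "inner (?T ** V) (G ** W) = inner V W"
      using inner_mult_left[of "?T ** V" G W] herm 2 by simp
    have "inner (W - ?T ** V) (G ** (W - ?T ** V)) = 2 * inner ?T B - 2 * inner V W"
      by (simp add: matmul.diff_right inner_diff_left inner_diff_right 1 2 3 TB inner_commute[of W V])
    moreover have "(norm (V - W))\<^sup>2 = inner (mat 1) B + inner (mat 1) A - 2 * inner V W"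
      by (simp add: V [symmetric] W [symmetric] norm_eq_inner_gram [symmetric])
        (simp add: power2_norm_eq_inner inner_diff_left inner_diff_right inner_commute)
    ultimately show ?thesis
      by (simp add: transport_cost_def)
  qed
  with G(1) that show thesis
    by blast
qed

lemma transport_cost_le:
  fixes A B V W :: "complex^'n^'n"
  assumes "pos_def A" "pos_def B" "V ** ctranspose V = B" "W ** ctranspose W = A"
  shows "transport_cost A B \<le> (norm (V - W))\<^sup>2"
    and "transport_cost A B = (norm (V - W))\<^sup>2 \<Longrightarrow> W = transport A B ** V"
proof -
  obtain G where G: "pos_def G" "(norm (V - W))\<^sup>2 - transport_cost A B
       = inner (W - transport A B ** V) (G ** (W - transport A B ** V))"
    using transport_gap[OF assms(1-3)] assms(4) by metis
  then show "transport_cost A B \<le> (norm (V - W))\<^sup>2"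
    using pos_def_imp_pos_semidef[OF G(1)] unfolding pos_semidef_iff by (smt (verit))
  assume "transport_cost A B = (norm (V - W))\<^sup>2"
  then have "inner (W - transport A B ** V) (G ** (W - transport A B ** V)) = 0"
    using G(2) by simp
  then show "W = transport A B ** V"
    using G(1) unfolding pos_def_iff by (metis less_irrefl eq_iff_diff_eq_0)
qed

section \<open>Measurability and integrals on the circle\<close>

lemma finite_measure_arc: "finite_measure arc"
  by (rule finite_measure_lebesgue_on) simp

text \<open>The measure is complete, so measurability passes to functions that agree almost everywhere. This
  is what allows \<^const>\<open>msqrt\<close> and \<^const>\<open>matrix_inv\<close> to take arbitrary values at the exceptional
  points where a density is not positive definite.\<close>

lemma borel_measurable_arc_AE:
  fixes f g :: "real \<Rightarrow> 'b::euclidean_space"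
  assumes f: "f \<in> borel_measurable arc" and ae: "AE x in arc. f x = g x"
  shows "g \<in> borel_measurable arc"
proof -
  let ?S = "{-pi..pi}"
  have "(\<lambda>x. if x \<in> ?S then f x else 0) \<in> borel_measurable lebesgue"
    using f by (simp add: borel_measurable_if del: atLeastAtMost_iff)
  moreover have "AE x in lebesgue. (if x \<in> ?S then f x else 0) = (if x \<in> ?S then g x else 0)"
    using ae by (simp add: AE_restrict_space_iff)
  ultimately have "(\<lambda>x. if x \<in> ?S then g x else 0) \<in> borel_measurable lebesgue"
    by (rule borel_measurable_AE)
  then show ?thesis
    by (simp add: borel_measurable_if del: atLeastAtMost_iff)
qed

text \<open>A countable union of the closed sets of matrices with a prescribed coercivity constant.\<close>

lemma borel_pos_def: "{A :: complex^'n^'n. pos_def A} \<in> sets borel"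
proof -
  have eq: "{A :: complex^'n^'n. pos_def A} = (\<Union>k. {A. coercive (inverse (real (Suc k))) A})"
  proof safe
    fix A :: "complex^'n^'n"
    assume "pos_def A"
    then obtain c where c: "0 < c" "coercive c A"
      by (rule pos_def_imp_coercive)
    obtain k where k: "inverse (real (Suc k)) < c"
      using reals_Archimedean[OF c(1)] by blast
    have "inverse (real (Suc k)) * (norm X)\<^sup>2 \<le> inner X (A ** X)" for X :: "complex^'n^'n"
    proof -
      have "inverse (real (Suc k)) * (norm X)\<^sup>2 \<le> c * (norm X)\<^sup>2"
        using k by (intro mult_right_mono) auto
      also have "\<dots> \<le> inner X (A ** X)"
        using c(2) by (simp add: coercive_def)
      finally show ?thesis .
    qed
    then show "A \<in> (\<Union>k. {A. coercive (inverse (real (Suc k))) A})"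
      using c(2) unfolding coercive_def by blast
  next
    fix A :: "complex^'n^'n" and k
    assume "coercive (inverse (real (Suc k))) A"
    then show "pos_def A"
      by (rule coercive_imp_pos_def) simp
  qed
  have "closed {A :: complex^'n^'n. coercive c A}" for c
    unfolding coercive_def
    by (intro closed_Collect_conj closed_Collect_all closed_Collect_eq closed_Collect_le
        continuous_ctranspose continuous_intros matmul.continuous_on)
  then show ?thesis
    unfolding eq by (intro sets.countable_UN) auto
qed

lemma circle_measurable_comp_pos_def:
  fixes F :: "complex \<Rightarrow> complex^'n^'n" and g :: "complex^'n^'n \<Rightarrow> complex^'n^'n"
  assumes F: "circle_measurable F" and ae: "AE_circle (\<lambda>z. pos_def (F z))"
    and g: "continuous_on {A. pos_def A} g"
  shows "circle_measurable (\<lambda>z. g (F z))"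
proof -
  have "(\<lambda>A. if A \<in> {A. pos_def A} then g A else 0) \<in> borel_measurable borel"
    by (intro borel_measurable_continuous_on_if borel_pos_def g continuous_intros)
  then have "(\<lambda>\<theta>. if F (cis \<theta>) \<in> {A. pos_def A} then g (F (cis \<theta>)) else 0) \<in> borel_measurable arc"
    using F unfolding circle_measurable_def by (rule measurable_compose[rotated])
  moreover have "AE \<theta> in arc. (if F (cis \<theta>) \<in> {A. pos_def A} then g (F (cis \<theta>)) else 0) = g (F (cis \<theta>))"
    using ae unfolding AE_circle_def by eventually_elim simp
  ultimately show ?thesis
    unfolding circle_measurable_def by (rule borel_measurable_arc_AE)
qed

lemma circle_measurable_mult:
  fixes F G :: "complex \<Rightarrow> complex^'n^'n"
  assumes "circle_measurable F" "circle_measurable G"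
  shows "circle_measurable (\<lambda>z. F z ** G z)"
  using assms unfolding circle_measurable_def
  by (rule borel_measurable_continuous_Pair) (intro matmul.continuous_on continuous_intros)

lemma spectral_density_pos_def:
  assumes "\<Phi> \<in> spectral_densities"
  shows "AE_circle (\<lambda>z. pos_def (\<Phi> z))"
proof -
  obtain c where c: "0 < c" "AE_circle (\<lambda>z. pos_def (\<Phi> z - mat (complex_of_real c)))"
    using assms unfolding spectral_densities_def by blast
  have mat: "mat (complex_of_real c) = c *\<^sub>R mat 1"
    by (simp add: mat_def vec_eq_iff of_real_def)
  have "pos_def A" if "pos_def (A - mat (complex_of_real c))" for A :: "complex^'n^'n"
    unfolding pos_def_iff
  proof safe
    have "ctranspose (A - mat (complex_of_real c)) = A - mat (complex_of_real c)"
      using that by (simp add: pos_def_iff)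
    then show "ctranspose A = A"
      by (simp add: mat ctranspose_diff ctranspose_scaleR)
    fix X :: "complex^'n^'n"
    assume "X \<noteq> 0"
    then have "0 < inner X ((A - mat (complex_of_real c)) ** X)"
      using that by (simp add: pos_def_iff)
    also have "\<dots> = inner X (A ** X) - c * (norm X)\<^sup>2"
      by (simp add: mat matmul.diff_left matmul.scaleR_left inner_diff_right power2_norm_eq_inner)
    also have "\<dots> \<le> inner X (A ** X)"
      using c(1) by simp
    finally show "0 < inner X (A ** X)" .
  qed
  then show ?thesis
    using c(2) unfolding AE_circle_def by (auto elim: AE_mp)
qed

lemma L2_iff:
  "F \<in> L2 \<longleftrightarrow> circle_measurable F \<and> circle_integrable (\<lambda>z. (norm (F z))\<^sup>2)"
  by (simp add: L2_def trace_mult_ctranspose)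

lemma L2norm_eq: "L2norm F = sqrt (circle_integral (\<lambda>z. (norm (F z))\<^sup>2))"
  by (simp add: L2norm_def trace_mult_ctranspose)

lemma L2norm_nonneg: "0 \<le> L2norm F"
  by (simp add: L2norm_eq circle_integral_def)

lemma L2norm_sq: "(L2norm F)\<^sup>2 = circle_integral (\<lambda>z. (norm (F z))\<^sup>2)"
  by (simp add: L2norm_eq circle_integral_def)

lemma L2norm_minus_commute: "L2norm (\<lambda>z. F z - G z) = L2norm (\<lambda>z. G z - F z)"
  by (simp add: L2norm_eq norm_minus_commute)

text \<open>\<open>\<parallel>W\<parallel>\<^sup>2\<close> is the trace of \<open>\<Phi>\<close>, which is bounded.\<close>

lemma spectral_factor_in_L2:
  fixes W :: "complex \<Rightarrow> complex^'p^'m"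
  assumes \<Phi>: "\<Phi> \<in> spectral_densities" and W: "spectral_factor \<Phi> W"
  shows "W \<in> L2"
proof -
  interpret arc: finite_measure arc
    by (rule finite_measure_arc)
  obtain B where B: "AE_circle (\<lambda>z. norm (\<Phi> z) \<le> B)"
    using \<Phi> unfolding spectral_densities_def by blast
  let ?one = "mat 1 :: complex^'m^'m"
  have meas: "(\<lambda>\<theta>. W (cis \<theta>)) \<in> borel_measurable arc"
    using W by (simp add: spectral_factor_def circle_measurable_def)
  have "AE \<theta> in arc. norm ((norm (W (cis \<theta>)))\<^sup>2) \<le> norm ?one * B"
  proof -
    have "AE \<theta> in arc. norm (\<Phi> (cis \<theta>)) \<le> B"
      "AE \<theta> in arc. W (cis \<theta>) ** ctranspose (W (cis \<theta>)) = \<Phi> (cis \<theta>)"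
      using B W by (auto simp: AE_circle_def spectral_factor_def)
    then show ?thesis
    proof eventually_elim
      case (elim \<theta>)
      have "\<bar>inner ?one (\<Phi> (cis \<theta>))\<bar> \<le> norm ?one * norm (\<Phi> (cis \<theta>))"
        by (rule Cauchy_Schwarz_ineq2)
      also have "\<dots> \<le> norm ?one * B"
        using elim(1) by (intro mult_left_mono) auto
      finally show ?case
        by (simp add: norm_eq_inner_gram elim(2))
    qed
  qed
  then have "integrable arc (\<lambda>\<theta>. (norm (W (cis \<theta>)))\<^sup>2)"
    using meas by (intro arc.integrable_const_bound) auto
  with W show ?thesis
    by (simp add: L2_iff circle_integrable_def spectral_factor_def)
qed

text \<open>A form of Minkowski's inequality with weights, linear in the squares, so that it can be integrated.
  The triangle inequality below chooses for \<open>a\<close> and \<open>b\<close> the two norms, enlarged by \<open>e / 2\<close> to keep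
  them positive.\<close>

lemma norm_add_sq_le:
  fixes x y :: "'a::real_inner"
  assumes "0 < a" "0 < b"
  shows "(norm (x + y))\<^sup>2 \<le> (1 + b / a) * (norm x)\<^sup>2 + (1 + a / b) * (norm y)\<^sup>2"
proof -
  have "(norm (x + y))\<^sup>2 \<le> (norm x + norm y)\<^sup>2"
    by (intro power_mono norm_triangle_ineq) simp
  moreover have "(1 + b / a) * (norm x)\<^sup>2 + (1 + a / b) * (norm y)\<^sup>2 - (norm x + norm y)\<^sup>2
      = (b * norm x - a * norm y)\<^sup>2 / (a * b)"
    using assms by (simp add: field_simps power2_eq_square)
  moreover have "0 \<le> (b * norm x - a * norm y)\<^sup>2 / (a * b)"
    using assms by simp
  ultimately show ?thesis
    by linarith
qed

lemma L2_add:
  assumes "F \<in> L2" "G \<in> L2"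
  shows "(\<lambda>z. F z + G z) \<in> L2"
proof -
  have meas: "(\<lambda>\<theta>. F (cis \<theta>) + G (cis \<theta>)) \<in> borel_measurable arc"
    using assms unfolding L2_iff circle_measurable_def by (intro borel_measurable_add) auto
  have int: "integrable arc (\<lambda>\<theta>. 2 * (norm (F (cis \<theta>)))\<^sup>2 + 2 * (norm (G (cis \<theta>)))\<^sup>2)"
    using assms unfolding L2_iff circle_integrable_def
    by (intro Bochner_Integration.integrable_add integrable_mult_right) auto
  have "integrable arc (\<lambda>\<theta>. (norm (F (cis \<theta>) + G (cis \<theta>)))\<^sup>2)"
    by (rule Bochner_Integration.integrable_bound[OF int])
      (use meas norm_add_sq_le[of 1 1 "F (cis _)" "G (cis _)"] in auto)
  with meas show ?thesis
    by (simp add: L2_iff circle_measurable_def circle_integrable_def)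
qed

lemma L2_diff:
  assumes "F \<in> L2" "G \<in> L2"
  shows "(\<lambda>z. F z - G z) \<in> L2"
proof -
  have "(\<lambda>z. - G z) \<in> L2"
    using assms(2) by (auto simp: L2_iff circle_measurable_def)
  from L2_add[OF assms(1) this] show ?thesis
    by simp
qed

lemma L2norm_triangle:
  assumes F: "F \<in> L2" and G: "G \<in> L2"
  shows "L2norm (\<lambda>z. F z + G z) \<le> L2norm F + L2norm G"
proof (rule field_le_epsilon)
  fix e :: real
  assume e: "0 < e"
  define a where "a = L2norm F + e / 2"
  define b where "b = L2norm G + e / 2"
  have ab: "0 < a" "0 < b" "L2norm F \<le> a" "L2norm G \<le> b"
    using e L2norm_nonneg[of F] L2norm_nonneg[of G] by (simp_all add: a_def b_def)
  have int: "integrable arc (\<lambda>\<theta>. (norm (F (cis \<theta>)))\<^sup>2)" "integrable arc (\<lambda>\<theta>. (norm (G (cis \<theta>)))\<^sup>2)"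
    "integrable arc (\<lambda>\<theta>. (norm (F (cis \<theta>) + G (cis \<theta>)))\<^sup>2)"
    using F G L2_add[OF F G] by (auto simp: L2_iff circle_integrable_def)
  have "(LINT \<theta>|arc. (norm (F (cis \<theta>) + G (cis \<theta>)))\<^sup>2)
      \<le> (LINT \<theta>|arc. (1 + b / a) * (norm (F (cis \<theta>)))\<^sup>2 + (1 + a / b) * (norm (G (cis \<theta>)))\<^sup>2)"
    using int ab(1,2)
    by (intro integral_mono norm_add_sq_le Bochner_Integration.integrable_add integrable_mult_right) auto
  also have "\<dots> = (1 + b / a) * (LINT \<theta>|arc. (norm (F (cis \<theta>)))\<^sup>2)
      + (1 + a / b) * (LINT \<theta>|arc. (norm (G (cis \<theta>)))\<^sup>2)"
    using int by simp
  finally have "(L2norm (\<lambda>z. F z + G z))\<^sup>2 \<le> (1 + b / a) * (L2norm F)\<^sup>2 + (1 + a / b) * (L2norm G)\<^sup>2"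
    unfolding L2norm_sq circle_integral_def times_divide_eq_right add_divide_distrib [symmetric]
    by (rule divide_right_mono) simp
  also have "\<dots> \<le> (1 + b / a) * a\<^sup>2 + (1 + a / b) * b\<^sup>2"
    using ab by (intro add_mono mult_left_mono power_mono L2norm_nonneg) auto
  also have "\<dots> = (a + b)\<^sup>2"
    using ab by (simp add: field_simps power2_eq_square)
  finally have "L2norm (\<lambda>z. F z + G z) \<le> a + b"
    by (rule power2_le_imp_le) (use ab in simp)
  then show "L2norm (\<lambda>z. F z + G z) \<le> L2norm F + L2norm G + e"
    by (simp add: a_def b_def)
qed

section \<open>Optimal spectral factors\<close>

lemma AE_circle_transport_hyps:
  assumes "\<Phi> \<in> spectral_densities" "\<Psi> \<in> spectral_densities"
    and "spectral_factor \<Psi> V" "spectral_factor \<Phi> W"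
  shows "AE_circle (\<lambda>z. pos_def (\<Phi> z) \<and> pos_def (\<Psi> z)
    \<and> V z ** ctranspose (V z) = \<Psi> z \<and> W z ** ctranspose (W z) = \<Phi> z)"
  using assms spectral_density_pos_def[OF assms(1)] spectral_density_pos_def[OF assms(2)]
  unfolding AE_circle_def spectral_factor_def by auto

lemma spectral_factor_msqrt:
  assumes \<Phi>: "\<Phi> \<in> spectral_densities"
  shows "spectral_factor \<Phi> (\<lambda>z. msqrt (\<Phi> z))"
  unfolding spectral_factor_def
proof
  note pd = spectral_density_pos_def[OF \<Phi>]
  show "circle_measurable (\<lambda>z. msqrt (\<Phi> z))"
    using \<Phi> by (intro circle_measurable_comp_pos_def[OF _ pd continuous_on_msqrt_pos_def])
      (simp add: spectral_densities_def)
  have "msqrt A ** ctranspose (msqrt A) = A" if "pos_def A" for A :: "complex^'n^'n"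
    using msqrt_pos_def[OF that] by (simp add: pos_def_iff)
  then show "AE_circle (\<lambda>z. msqrt (\<Phi> z) ** ctranspose (msqrt (\<Phi> z)) = \<Phi> z)"
    using pd unfolding AE_circle_def by auto
qed

lemma spectral_factor_W_hat:
  assumes \<Phi>: "\<Phi> \<in> spectral_densities" and \<Psi>: "\<Psi> \<in> spectral_densities"
    and V: "spectral_factor \<Psi> V"
  shows "spectral_factor \<Phi> (W_hat \<Phi> \<Psi> V)"
proof -
  let ?S = "\<lambda>z. msqrt (\<Phi> z)"
  let ?M = "\<lambda>z. ?S z ** \<Psi> z ** ?S z"
  have S: "circle_measurable ?S"
    using spectral_factor_msqrt[OF \<Phi>] by (simp add: spectral_factor_def)
  have "circle_measurable \<Psi>"
    using \<Psi> by (simp add: spectral_densities_def)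
  with S have M: "circle_measurable ?M"
    by (intro circle_measurable_mult)
  have pd: "AE_circle (\<lambda>z. pos_def (\<Phi> z) \<and> pos_def (\<Psi> z) \<and> V z ** ctranspose (V z) = \<Psi> z)"
    using AE_circle_transport_hyps[OF \<Phi> \<Psi> V spectral_factor_msqrt[OF \<Phi>]]
    unfolding AE_circle_def by auto
  have pdM: "AE_circle (\<lambda>z. pos_def (?M z))"
    using pd unfolding AE_circle_def by (auto intro: pos_def_sandwich)
  then have pdR: "AE_circle (\<lambda>z. pos_def (msqrt (?M z)))"
    unfolding AE_circle_def by (auto intro: msqrt_pos_def(1))
  have "circle_measurable (\<lambda>z. matrix_inv (msqrt (?M z)))"
    by (rule circle_measurable_comp_pos_def[OF _ pdR continuous_on_matrix_inv_pos_def])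
      (rule circle_measurable_comp_pos_def[OF M pdM continuous_on_msqrt_pos_def])
  then have "circle_measurable (\<lambda>z. transport (\<Phi> z) (\<Psi> z) ** V z)"
    using S V unfolding transport_def by (intro circle_measurable_mult) (auto simp: spectral_factor_def)
  moreover have "AE_circle (\<lambda>z. (transport (\<Phi> z) (\<Psi> z) ** V z)
      ** ctranspose (transport (\<Phi> z) (\<Psi> z) ** V z) = \<Phi> z)"
    using pd unfolding AE_circle_def by (auto intro: transport_factor)
  ultimately show ?thesis
    by (simp add: spectral_factor_def W_hat_eq_transport)
qed

lemma circle_integral_cong_AE:
  assumes "circle_integrable f" "circle_integrable g" "AE_circle (\<lambda>z. f z = g z)"
  shows "circle_integral f = circle_integral g"
proof -
  have "(LINT \<theta>|arc. f (cis \<theta>)) = (LINT \<theta>|arc. g (cis \<theta>))"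
    using assms unfolding circle_integrable_def AE_circle_def by (intro integral_cong_AE) auto
  then show ?thesis
    by (simp add: circle_integral_def)
qed

lemma circle_integral_mono_AE:
  assumes f: "circle_integrable f" and g: "circle_integrable g" and le: "AE_circle (\<lambda>z. f z \<le> g z)"
  shows "circle_integral f \<le> circle_integral g"
    and "circle_integral f = circle_integral g \<Longrightarrow> AE_circle (\<lambda>z. f z = g z)"
proof -
  have int: "integrable arc (\<lambda>\<theta>. f (cis \<theta>))" "integrable arc (\<lambda>\<theta>. g (cis \<theta>))"
    using f g by (auto simp: circle_integrable_def)
  show "circle_integral f \<le> circle_integral g"
    using integral_mono_AE[OF int] le
    unfolding circle_integral_def AE_circle_def by (simp add: divide_right_mono)
  assume "circle_integral f = circle_integral g"
  then have "(LINT \<theta>|arc. g (cis \<theta>) - f (cis \<theta>)) = 0"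
    using int by (simp add: circle_integral_def)
  moreover have "AE \<theta> in arc. 0 \<le> g (cis \<theta>) - f (cis \<theta>)"
    using le by (simp add: AE_circle_def)
  ultimately have "AE \<theta> in arc. g (cis \<theta>) - f (cis \<theta>) = 0"
    using int by (subst (asm) integral_nonneg_eq_0_iff_AE) auto
  then show "AE_circle (\<lambda>z. f z = g z)"
    unfolding AE_circle_def by (auto elim: AE_mp)
qed

text \<open>The minimal squared distance between factors. It is written as a distance of two particular factors,
  rather than as the integral of \<^const>\<open>transport_cost\<close>, so that integrability comes with
  membership in \<^const>\<open>L2\<close>.\<close>

definition factor_cost :: "(complex \<Rightarrow> complex^'n^'n) \<Rightarrow> (complex \<Rightarrow> complex^'n^'n) \<Rightarrow> real" where
  "factor_cost \<Phi> \<Psi> = circle_integral (\<lambda>z. (norm (msqrt (\<Psi> z) - W_hat \<Phi> \<Psi> (\<lambda>z. msqrt (\<Psi> z)) z))\<^sup>2)"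

lemma circle_integrable_norm_diff_factors:
  assumes "\<Phi> \<in> spectral_densities" "\<Psi> \<in> spectral_densities"
    and "spectral_factor \<Psi> V" "spectral_factor \<Phi> W"
  shows "circle_integrable (\<lambda>z. (norm (V z - W z))\<^sup>2)"
  using L2_diff[OF spectral_factor_in_L2[OF assms(2,3)] spectral_factor_in_L2[OF assms(1,4)]]
  by (simp add: L2_iff)

text \<open>Both sides are integrals of the transport cost of \<open>\<Phi>\<close> and \<open>\<Psi>\<close>.\<close>

lemma L2norm_diff_W_hat:
  assumes \<Phi>: "\<Phi> \<in> spectral_densities" and \<Psi>: "\<Psi> \<in> spectral_densities"
    and V: "spectral_factor \<Psi> V"
  shows "(L2norm (\<lambda>z. V z - W_hat \<Phi> \<Psi> V z))\<^sup>2 = factor_cost \<Phi> \<Psi>"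
proof -
  let ?V' = "\<lambda>z. msqrt (\<Psi> z)"
  have V': "spectral_factor \<Psi> ?V'"
    by (rule spectral_factor_msqrt[OF \<Psi>])
  have "AE_circle (\<lambda>z. (norm (V z - W_hat \<Phi> \<Psi> V z))\<^sup>2 = (norm (?V' z - W_hat \<Phi> \<Psi> ?V' z))\<^sup>2)"
    using AE_circle_transport_hyps[OF \<Phi> \<Psi> V spectral_factor_msqrt[OF \<Phi>]]
      AE_circle_transport_hyps[OF \<Phi> \<Psi> V' spectral_factor_msqrt[OF \<Phi>]]
    unfolding AE_circle_def W_hat_eq_transport
    by eventually_elim (simp only: norm_diff_transport)
  then show ?thesis
    unfolding L2norm_sq factor_cost_def
    by (intro circle_integral_cong_AE circle_integrable_norm_diff_factors[OF \<Phi> \<Psi>] V V' spectral_factor_W_hat[OF \<Phi> \<Psi>])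
qed

lemma factor_cost_le:
  assumes \<Phi>: "\<Phi> \<in> spectral_densities" and \<Psi>: "\<Psi> \<in> spectral_densities"
    and V: "spectral_factor \<Psi> V" and W: "spectral_factor \<Phi> W"
  shows "factor_cost \<Phi> \<Psi> \<le> (L2norm (\<lambda>z. V z - W z))\<^sup>2"
    and "(L2norm (\<lambda>z. V z - W z))\<^sup>2 = factor_cost \<Phi> \<Psi> \<Longrightarrow> AE_circle (\<lambda>z. W z = W_hat \<Phi> \<Psi> V z)"
proof -
  let ?f = "\<lambda>z. (norm (V z - W_hat \<Phi> \<Psi> V z))\<^sup>2" and ?g = "\<lambda>z. (norm (V z - W z))\<^sup>2"
  note hyps = AE_circle_transport_hyps[OF \<Phi> \<Psi> V W]
  have int: "circle_integrable ?f" "circle_integrable ?g"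
    using circle_integrable_norm_diff_factors[OF \<Phi> \<Psi> V] W spectral_factor_W_hat[OF \<Phi> \<Psi> V] by blast+
  have le: "AE_circle (\<lambda>z. ?f z \<le> ?g z)"
    using hyps unfolding AE_circle_def W_hat_eq_transport
    by eventually_elim (simp only: norm_diff_transport transport_cost_le)
  show "factor_cost \<Phi> \<Psi> \<le> (L2norm (\<lambda>z. V z - W z))\<^sup>2"
    unfolding L2norm_diff_W_hat[OF \<Phi> \<Psi> V, symmetric] unfolding L2norm_sq
    by (rule circle_integral_mono_AE(1)[OF int le])
  assume "(L2norm (\<lambda>z. V z - W z))\<^sup>2 = factor_cost \<Phi> \<Psi>"
  then have "circle_integral ?f = circle_integral ?g"
    unfolding L2norm_diff_W_hat[OF \<Phi> \<Psi> V, symmetric] unfolding L2norm_sq by simp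
  then have "AE_circle (\<lambda>z. ?f z = ?g z)"
    by (rule circle_integral_mono_AE(2)[OF int le])
  then show "AE_circle (\<lambda>z. W z = W_hat \<Phi> \<Psi> V z)"
    using hyps unfolding AE_circle_def W_hat_eq_transport
    by eventually_elim (metis norm_diff_transport transport_cost_le(2))
qed

lemma Inf_fixed_factor:
  fixes V :: "complex \<Rightarrow> complex^'n^'n"
  assumes \<Phi>: "\<Phi> \<in> spectral_densities" and \<Psi>: "\<Psi> \<in> spectral_densities"
    and V: "spectral_factor \<Psi> V"
  shows "Inf {(L2norm (\<lambda>z. V z - W z))\<^sup>2 | W :: complex \<Rightarrow> complex^'n^'n.
    W \<in> L2 \<and> spectral_factor \<Phi> W} = factor_cost \<Phi> \<Psi>"
proof (rule cInf_eq_minimum)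
  show "factor_cost \<Phi> \<Psi> \<in> {(L2norm (\<lambda>z. V z - W z))\<^sup>2 | W. W \<in> L2 \<and> spectral_factor \<Phi> W}"
    unfolding L2norm_diff_W_hat[OF assms, symmetric]
    using spectral_factor_W_hat[OF assms] spectral_factor_in_L2[OF \<Phi>]
    by (intro CollectI exI[of _ "W_hat \<Phi> \<Psi> V"]) auto
  show "factor_cost \<Phi> \<Psi> \<le> x"
    if "x \<in> {(L2norm (\<lambda>z. V z - W z))\<^sup>2 | W. W \<in> L2 \<and> spectral_factor \<Phi> W}" for x
    using that factor_cost_le(1)[OF assms] by auto
qed

lemma dH_tilde_eq:
  fixes \<Phi> \<Psi> :: "complex \<Rightarrow> complex^'n^'n"
  assumes \<Phi>: "\<Phi> \<in> spectral_densities" and \<Psi>: "\<Psi> \<in> spectral_densities"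
  shows "dH_tilde \<Phi> \<Psi> = sqrt (factor_cost \<Phi> \<Psi>)"
proof -
  let ?X = "{(L2norm (\<lambda>z. V z - W z))\<^sup>2 | V W :: complex \<Rightarrow> complex^'n^'n.
     V \<in> L2 \<and> W \<in> L2 \<and> spectral_factor \<Psi> V \<and> spectral_factor \<Phi> W}"
  have "Inf ?X = factor_cost \<Phi> \<Psi>"
  proof (rule cInf_eq_minimum)
    let ?V = "\<lambda>z. msqrt (\<Psi> z)"
    have V: "spectral_factor \<Psi> ?V"
      by (rule spectral_factor_msqrt[OF \<Psi>])
    note W = spectral_factor_W_hat[OF \<Phi> \<Psi> V]
    show "factor_cost \<Phi> \<Psi> \<in> ?X"
      unfolding L2norm_diff_W_hat[OF \<Phi> \<Psi> V, symmetric]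
      using V W spectral_factor_in_L2[OF \<Phi> W] spectral_factor_in_L2[OF \<Psi> V]
      by (intro CollectI exI[of _ ?V] exI[of _ "W_hat \<Phi> \<Psi> ?V"]) auto
    show "factor_cost \<Phi> \<Psi> \<le> x" if "x \<in> ?X" for x
      using that factor_cost_le(1)[OF \<Phi> \<Psi>] by auto
  qed
  then show ?thesis
    by (simp add: dH_tilde_def)
qed

section \<open>The metric\<close>

lemma dH_tilde_nonneg:
  assumes "\<Phi> \<in> spectral_densities" "\<Psi> \<in> spectral_densities"
  shows "0 \<le> dH_tilde \<Phi> \<Psi>"
proof -
  have "0 \<le> factor_cost \<Phi> \<Psi>"
    using L2norm_diff_W_hat[OF assms spectral_factor_msqrt[OF assms(2)]] zero_le_power2 by metis
  then show ?thesis
    by (simp add: dH_tilde_eq[OF assms])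
qed

lemma dH_tilde_le:
  fixes V W :: "complex \<Rightarrow> complex^'n^'n"
  assumes "\<Phi> \<in> spectral_densities" "\<Psi> \<in> spectral_densities"
    and "spectral_factor \<Psi> V" "spectral_factor \<Phi> W"
  shows "dH_tilde \<Phi> \<Psi> \<le> L2norm (\<lambda>z. V z - W z)"
  using factor_cost_le(1)[OF assms] L2norm_nonneg
  unfolding dH_tilde_eq[OF assms(1,2)] by (rule real_le_lsqrt[rotated])

lemma dH_tilde_attained:
  fixes V :: "complex \<Rightarrow> complex^'n^'n"
  assumes "\<Phi> \<in> spectral_densities" "\<Psi> \<in> spectral_densities" "spectral_factor \<Psi> V"
  obtains W where "spectral_factor \<Phi> W" "L2norm (\<lambda>z. V z - W z) = dH_tilde \<Phi> \<Psi>"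
proof
  show "spectral_factor \<Phi> (W_hat \<Phi> \<Psi> V)"
    by (rule spectral_factor_W_hat[OF assms])
  show "L2norm (\<lambda>z. V z - W_hat \<Phi> \<Psi> V z) = dH_tilde \<Phi> \<Psi>"
    unfolding dH_tilde_eq[OF assms(1,2)] L2norm_diff_W_hat[OF assms, symmetric]
    by (simp add: L2norm_nonneg)
qed

text \<open>The infimum is attained whichever factor of the second density is prescribed. Hence
  symmetry and the triangle inequality can be read off from suitable factors: for the latter, all
  three densities are factored so that two of the distances are measured from the same factor of
  the middle density.\<close>

lemma dH_tilde_commute:
  fixes \<Phi> \<Psi> :: "complex \<Rightarrow> complex^'n^'n"
  assumes \<Phi>: "\<Phi> \<in> spectral_densities" and \<Psi>: "\<Psi> \<in> spectral_densities"
  shows "dH_tilde \<Phi> \<Psi> = dH_tilde \<Psi> \<Phi>"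
proof -
  have "dH_tilde \<Psi> \<Phi> \<le> dH_tilde \<Phi> \<Psi>"
    if \<Phi>: "\<Phi> \<in> spectral_densities" and \<Psi>: "\<Psi> \<in> spectral_densities"
    for \<Phi> \<Psi> :: "complex \<Rightarrow> complex^'n^'n"
  proof -
    note V = spectral_factor_msqrt[OF \<Psi>]
    obtain W where W: "spectral_factor \<Phi> W" "L2norm (\<lambda>z. msqrt (\<Psi> z) - W z) = dH_tilde \<Phi> \<Psi>"
      by (rule dH_tilde_attained[OF \<Phi> \<Psi> V])
    have "dH_tilde \<Psi> \<Phi> \<le> L2norm (\<lambda>z. W z - msqrt (\<Psi> z))"
      by (rule dH_tilde_le[OF \<Psi> \<Phi> W(1) V])
    also have "\<dots> = dH_tilde \<Phi> \<Psi>"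
      by (subst L2norm_minus_commute) (rule W(2))
    finally show ?thesis .
  qed
  then show ?thesis
    using \<Phi> \<Psi> by (intro antisym) auto
qed

lemma dH_tilde_triangle:
  assumes "\<Phi> \<in> spectral_densities" "\<Psi> \<in> spectral_densities" "\<Omega> \<in> spectral_densities"
  shows "dH_tilde \<Phi> \<Omega> \<le> dH_tilde \<Phi> \<Psi> + dH_tilde \<Psi> \<Omega>"
proof -
  let ?V = "\<lambda>z. msqrt (\<Psi> z)"
  have V: "spectral_factor \<Psi> ?V"
    by (rule spectral_factor_msqrt[OF assms(2)])
  obtain W where W: "spectral_factor \<Phi> W" "L2norm (\<lambda>z. ?V z - W z) = dH_tilde \<Phi> \<Psi>"
    by (rule dH_tilde_attained[OF assms(1,2) V])
  obtain U where U: "spectral_factor \<Omega> U" "L2norm (\<lambda>z. ?V z - U z) = dH_tilde \<Omega> \<Psi>"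
    by (rule dH_tilde_attained[OF assms(3,2) V])
  have L2: "?V \<in> L2" "W \<in> L2" "U \<in> L2"
    using spectral_factor_in_L2 assms V W(1) U(1) by blast+
  have "dH_tilde \<Phi> \<Omega> \<le> L2norm (\<lambda>z. U z - W z)"
    by (rule dH_tilde_le[OF assms(1,3) U(1) W(1)])
  also have "\<dots> \<le> L2norm (\<lambda>z. U z - ?V z) + L2norm (\<lambda>z. ?V z - W z)"
    using L2norm_triangle[OF L2_diff[OF L2(3,1)] L2_diff[OF L2(1,2)]] by simp
  also have "\<dots> = dH_tilde \<Phi> \<Psi> + dH_tilde \<Psi> \<Omega>"
    by (subst L2norm_minus_commute) (simp add: W U dH_tilde_commute[OF assms(3,2)])
  finally show ?thesis .
qed

lemma spectral_factor_cong_AE: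
  assumes "AE_circle (\<lambda>z. \<Phi> z = \<Phi>' z)"
  shows "spectral_factor \<Phi> W \<longleftrightarrow> spectral_factor \<Phi>' W"
  using assms unfolding spectral_factor_def AE_circle_def by (auto elim: AE_mp)

lemma dH_tilde_respects_ae_rel: "congruent2 ae_rel ae_rel dH_tilde"
proof (rule congruent2I')
  fix \<Phi> \<Phi>' \<Psi> \<Psi>' :: "complex \<Rightarrow> complex^'n^'n"
  assume "(\<Phi>, \<Phi>') \<in> ae_rel" "(\<Psi>, \<Psi>') \<in> ae_rel"
  then have "spectral_factor \<Phi> W \<longleftrightarrow> spectral_factor \<Phi>' W" "spectral_factor \<Psi> W \<longleftrightarrow> spectral_factor \<Psi>' W"
    for W :: "complex \<Rightarrow> complex^'n^'n"
    using spectral_factor_cong_AE by (auto simp: ae_rel_def)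
  then show "dH_tilde \<Phi> \<Psi> = dH_tilde \<Phi>' \<Psi>'"
    unfolding dH_tilde_def by simp
qed

lemma dH_tilde_eq_0_iff:
  assumes \<Phi>: "\<Phi> \<in> spectral_densities" and \<Psi>: "\<Psi> \<in> spectral_densities"
  shows "dH_tilde \<Phi> \<Psi> = 0 \<longleftrightarrow> (\<Phi>, \<Psi>) \<in> ae_rel"
proof
  let ?V = "\<lambda>z. msqrt (\<Psi> z)"
  have V: "spectral_factor \<Psi> ?V"
    by (rule spectral_factor_msqrt[OF \<Psi>])
  {
    assume "dH_tilde \<Phi> \<Psi> = 0"
    then obtain W where W: "spectral_factor \<Phi> W" "L2norm (\<lambda>z. ?V z - W z) = 0"
      using dH_tilde_attained[OF \<Phi> \<Psi> V] by metis
    have "circle_integral (\<lambda>z. 0) = circle_integral (\<lambda>z. (norm (?V z - W z))\<^sup>2)"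
      using W(2) by (simp add: L2norm_eq circle_integral_def)
    then have "AE_circle (\<lambda>z. 0 = (norm (?V z - W z))\<^sup>2)"
      by (intro circle_integral_mono_AE(2) circle_integrable_norm_diff_factors[OF \<Phi> \<Psi> V W(1)])
        (auto simp: circle_integrable_def AE_circle_def)
    then have "AE_circle (\<lambda>z. \<Phi> z = \<Psi> z)"
      using V W(1) unfolding spectral_factor_def AE_circle_def by (auto elim: AE_mp)
    with assms show "(\<Phi>, \<Psi>) \<in> ae_rel"
      by (simp add: ae_rel_def)
  next
    assume "(\<Phi>, \<Psi>) \<in> ae_rel"
    then have "spectral_factor \<Phi> ?V"
      using V spectral_factor_cong_AE by (auto simp: ae_rel_def)
    then have "dH_tilde \<Phi> \<Psi> \<le> L2norm (\<lambda>z. ?V z - ?V z)"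
      by (rule dH_tilde_le[OF \<Phi> \<Psi> V])
    then show "dH_tilde \<Phi> \<Psi> = 0"
      using dH_tilde_nonneg[OF \<Phi> \<Psi>] by (simp add: L2norm_eq circle_integral_def)
  }
qed

lemma dH_class_eq:
  assumes "\<Phi> \<in> spectral_densities" "\<Psi> \<in> spectral_densities"
  shows "dH_class (ae_rel `` {\<Phi>}) (ae_rel `` {\<Psi>}) = dH_tilde \<Phi> \<Psi>"
proof -
  have "congruent2 ae_rel ae_rel (\<lambda>\<Phi> \<Psi>. {dH_tilde \<Phi> \<Psi>})"
    using dH_tilde_respects_ae_rel by (auto simp: congruent2_def)
  from UN_equiv_class2[OF equiv_ae_rel equiv_ae_rel this assms] assms show ?thesis
    by (simp add: dH_class_def quotientI)
qed

lemma Metric_space_dH_class: "Metric_space (spectral_densities // ae_rel) dH_class"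
proof
  fix X Y Z :: "(complex \<Rightarrow> complex^'n^'n) set"
  let ?Q = "spectral_densities // ae_rel"
  show "0 \<le> dH_class X Y"
  proof (cases "X \<in> ?Q \<and> Y \<in> ?Q")
    case True
    then show ?thesis
      by (auto elim!: quotientE simp: dH_class_eq dH_tilde_nonneg)
  qed (auto simp: dH_class_def)
  show "dH_class X Y = dH_class Y X"
  proof (cases "X \<in> ?Q \<and> Y \<in> ?Q")
    case True
    then show ?thesis
      by (auto elim!: quotientE simp: dH_class_eq dH_tilde_commute)
  qed (auto simp: dH_class_def)
  show "dH_class X Y = 0 \<longleftrightarrow> X = Y" if "X \<in> ?Q" "Y \<in> ?Q"
    using that
    by (elim quotientE) (simp add: dH_class_eq dH_tilde_eq_0_iff eq_equiv_class_iff[OF equiv_ae_rel])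
  show "dH_class X Z \<le> dH_class X Y + dH_class Y Z" if "X \<in> ?Q" "Y \<in> ?Q" "Z \<in> ?Q"
    using that by (auto elim!: quotientE simp: dH_class_eq dH_tilde_triangle)
qed

section \<open>The scalar case\<close>

lemma norm_scalar_factor:
  fixes V :: "complex^'n^'n"
  assumes "UNIV = {i :: 'n}"
  shows "norm V = sqrt (Re ((V ** ctranspose V) $ i $ i))"
proof -
  have "(norm V)\<^sup>2 = Re ((V ** ctranspose V) $ i $ i)"
    unfolding trace_mult_ctranspose [symmetric] by (simp add: trace_def assms)
  then show ?thesis
    by (metis norm_ge_zero real_sqrt_unique)
qed

text \<open>The norm of a \<open>1\<times>1\<close> factor is determined by the density, so
  \<open>\<parallel>V - W\<parallel> \<ge> \<bar>\<parallel>V\<parallel> - \<parallel>W\<parallel>\<bar> = \<bar>\<surd>\<Psi> - \<surd>\<Phi>\<bar>\<close> for all factors, with equality for the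
  non-negative ones.\<close>

lemma scalar_dH_tilde_eq_hellinger:
  fixes \<Phi> \<Psi> :: "complex \<Rightarrow> complex^'n^'n"
  assumes n: "CARD('n) = 1" and \<Phi>: "\<Phi> \<in> spectral_densities" and \<Psi>: "\<Psi> \<in> spectral_densities"
  shows "dH_tilde \<Phi> \<Psi> = hellinger (\<lambda>z. Re (\<Phi> z $ i $ i)) (\<lambda>z. Re (\<Psi> z $ i $ i))"
proof -
  have U: "UNIV = {i :: 'n}"
    using n by (metis UNIV_I card_1_singletonE singletonD)
  have all: "(\<forall>k :: 'n. P k) \<longleftrightarrow> P i" for P
    using U by (metis UNIV_I singletonD)
  define w where "w = (\<lambda>A :: complex^'n^'n. mat (complex_of_real (sqrt (Re (A $ i $ i)))) :: complex^'n^'n)"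
  have factor: "spectral_factor F (\<lambda>z. w (F z))" if F: "F \<in> spectral_densities" for F
    unfolding spectral_factor_def
  proof
    have "continuous_on UNIV w"
      unfolding w_def mat_def
    proof (intro continuous_on_vec_lambda)
      show "continuous_on UNIV (\<lambda>A :: complex^'n^'n. if j = k
          then complex_of_real (sqrt (Re (A $ i $ i))) else 0)" for j k :: 'n
        by (cases "j = k") (auto intro!: continuous_intros)
    qed
    then show "circle_measurable (\<lambda>z. w (F z))"
      using F unfolding spectral_densities_def circle_measurable_def
      by (auto intro: borel_measurable_continuous_on)
    have "w A ** ctranspose (w A) = A" if A: "pos_def A" for A
    proof -
      have "mat 1 \<noteq> (0 :: complex^'n^'n)"
        by (auto simp: vec_eq_iff mat_def)
      then have "ctranspose A = A" "0 < inner (mat 1) A"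
        using A unfolding pos_def_iff by (auto dest: spec[of _ "mat 1"])
      then have "cnj (A $ i $ i) = A $ i $ i" "0 \<le> Re (A $ i $ i)"
        by (auto simp: vec_eq_iff all ctranspose_def inner_vec_def U mat_def inner_complex_def)
      then show ?thesis
        by (simp add: vec_eq_iff all w_def matrix_matrix_mult_def U ctranspose_def mat_def complex_eq_iff)
    qed
    then show "AE_circle (\<lambda>z. w (F z) ** ctranspose (w (F z)) = F z)"
      using spectral_density_pos_def[OF F] unfolding AE_circle_def by auto
  qed
  let ?h = "\<lambda>z. (sqrt (Re (\<Phi> z $ i $ i)) - sqrt (Re (\<Psi> z $ i $ i)))\<^sup>2"
  have "norm (w A - w B) = \<bar>sqrt (Re (B $ i $ i)) - sqrt (Re (A $ i $ i))\<bar>" for A B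
    by (simp add: norm_vec_def U L2_set_def w_def mat_def norm_of_real of_real_diff [symmetric] del: of_real_diff)
  then have h: "(norm (w (\<Psi> z) - w (\<Phi> z)))\<^sup>2 = ?h z" for z
    by simp
  have int: "circle_integrable ?h"
    using circle_integrable_norm_diff_factors[OF \<Phi> \<Psi> factor[OF \<Psi>] factor[OF \<Phi>]] by (simp add: h)
  have "factor_cost \<Phi> \<Psi> = circle_integral ?h"
  proof (rule antisym)
    show "factor_cost \<Phi> \<Psi> \<le> circle_integral ?h"
      using factor_cost_le(1)[OF \<Phi> \<Psi> factor[OF \<Psi>] factor[OF \<Phi>]] by (simp add: L2norm_sq h)
    let ?V = "\<lambda>z. msqrt (\<Psi> z)"
    have V: "spectral_factor \<Psi> ?V"
      by (rule spectral_factor_msqrt[OF \<Psi>])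
    note W = spectral_factor_W_hat[OF \<Phi> \<Psi> V]
    have "AE_circle (\<lambda>z. ?h z \<le> (norm (?V z - W_hat \<Phi> \<Psi> ?V z))\<^sup>2)"
      using AE_circle_transport_hyps[OF \<Phi> \<Psi> V W] unfolding AE_circle_def
    proof eventually_elim
      case (elim \<theta>)
      let ?x = "?V (cis \<theta>)" and ?y = "W_hat \<Phi> \<Psi> ?V (cis \<theta>)"
      have "?h (cis \<theta>) = \<bar>norm ?x - norm ?y\<bar>\<^sup>2"
        using elim by (simp add: norm_scalar_factor[OF U] power2_commute)
      also have "\<dots> \<le> (norm (?x - ?y))\<^sup>2"
        by (intro power_mono norm_triangle_ineq3) simp
      finally show ?case .
    qed
    then show "circle_integral ?h \<le> factor_cost \<Phi> \<Psi>"
      unfolding factor_cost_def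
      by (intro circle_integral_mono_AE(1) int circle_integrable_norm_diff_factors[OF \<Phi> \<Psi> V W])
  qed
  then show ?thesis
    by (simp add: dH_tilde_eq[OF \<Phi> \<Psi>] hellinger_def)
qed

theorem theorem6p1:
  shows "(\<forall>\<Phi> \<in> spectral_densities. \<forall>\<Psi> \<in> spectral_densities.
      \<forall>W\<^sub>\<Psi> :: complex \<Rightarrow> complex^'n^'n. spectral_factor \<Psi> W\<^sub>\<Psi> \<longrightarrow>
        dH_tilde \<Phi> \<Psi> = sqrt (Inf {(L2norm (\<lambda>z. W\<^sub>\<Psi> z - W\<^sub>\<Phi> z))\<^sup>2 | W\<^sub>\<Phi> :: complex \<Rightarrow> complex^'n^'n.
          W\<^sub>\<Phi> \<in> L2 \<and> spectral_factor \<Phi> W\<^sub>\<Phi>}))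
    \<and> (\<forall>\<Phi> \<in> spectral_densities. \<forall>\<Psi> \<in> spectral_densities.
      \<forall>W\<^sub>\<Psi> :: complex \<Rightarrow> complex^'n^'n. spectral_factor \<Psi> W\<^sub>\<Psi> \<longrightarrow>
        W_hat \<Phi> \<Psi> W\<^sub>\<Psi> \<in> L2 \<and> spectral_factor \<Phi> (W_hat \<Phi> \<Psi> W\<^sub>\<Psi>)
        \<and> (L2norm (\<lambda>z. W\<^sub>\<Psi> z - W_hat \<Phi> \<Psi> W\<^sub>\<Psi> z))\<^sup>2
            = Inf {(L2norm (\<lambda>z. W\<^sub>\<Psi> z - W\<^sub>\<Phi> z))\<^sup>2 | W\<^sub>\<Phi> :: complex \<Rightarrow> complex^'n^'n.
                W\<^sub>\<Phi> \<in> L2 \<and> spectral_factor \<Phi> W\<^sub>\<Phi>}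
        \<and> (\<forall>W :: complex \<Rightarrow> complex^'n^'n. spectral_factor \<Phi> W \<longrightarrow>
            (L2norm (\<lambda>z. W\<^sub>\<Psi> z - W z))\<^sup>2
              = Inf {(L2norm (\<lambda>z. W\<^sub>\<Psi> z - W\<^sub>\<Phi> z))\<^sup>2 | W\<^sub>\<Phi> :: complex \<Rightarrow> complex^'n^'n.
                  W\<^sub>\<Phi> \<in> L2 \<and> spectral_factor \<Phi> W\<^sub>\<Phi>}
            \<longrightarrow> AE_circle (\<lambda>z. W z = W_hat \<Phi> \<Psi> W\<^sub>\<Psi> z)))
    \<and> (congruent2 ae_rel ae_rel
        (dH_tilde :: (complex \<Rightarrow> complex^'n^'n) \<Rightarrow> (complex \<Rightarrow> complex^'n^'n) \<Rightarrow> real)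
      \<and> Metric_space (spectral_densities // ae_rel)
        (dH_class :: (complex \<Rightarrow> complex^'n^'n) set \<Rightarrow> (complex \<Rightarrow> complex^'n^'n) set \<Rightarrow> real))
    \<and> (CARD('n) = 1 \<longrightarrow>
      (\<forall>\<Phi> \<in> spectral_densities. \<forall>\<Psi> \<in> spectral_densities. \<forall>i::'n.
        dH_tilde \<Phi> \<Psi> = hellinger (\<lambda>z. Re (\<Phi> z $ i $ i)) (\<lambda>z. Re (\<Psi> z $ i $ i))))"
proof (intro conjI ballI allI impI)
  fix \<Phi> \<Psi> :: "complex \<Rightarrow> complex^'n^'n" and V :: "complex \<Rightarrow> complex^'n^'n"
  assume \<Phi>: "\<Phi> \<in> spectral_densities" and \<Psi>: "\<Psi> \<in> spectral_densities" and V: "spectral_factor \<Psi> V"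
  note Inf_eq = Inf_fixed_factor[OF \<Phi> \<Psi> V]
  show "dH_tilde \<Phi> \<Psi> = sqrt (Inf {(L2norm (\<lambda>z. V z - W z))\<^sup>2 | W :: complex \<Rightarrow> complex^'n^'n.
      W \<in> L2 \<and> spectral_factor \<Phi> W})"
    unfolding Inf_eq by (rule dH_tilde_eq[OF \<Phi> \<Psi>])
  show "spectral_factor \<Phi> (W_hat \<Phi> \<Psi> V)"
    by (rule spectral_factor_W_hat[OF \<Phi> \<Psi> V])
  then show "W_hat \<Phi> \<Psi> V \<in> L2"
    by (rule spectral_factor_in_L2[OF \<Phi>])
  show "(L2norm (\<lambda>z. V z - W_hat \<Phi> \<Psi> V z))\<^sup>2
      = Inf {(L2norm (\<lambda>z. V z - W z))\<^sup>2 | W :: complex \<Rightarrow> complex^'n^'n.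
          W \<in> L2 \<and> spectral_factor \<Phi> W}"
    unfolding Inf_eq by (rule L2norm_diff_W_hat[OF \<Phi> \<Psi> V])
  fix W :: "complex \<Rightarrow> complex^'n^'n"
  assume "spectral_factor \<Phi> W"
    and "(L2norm (\<lambda>z. V z - W z))\<^sup>2
      = Inf {(L2norm (\<lambda>z. V z - W z))\<^sup>2 | W :: complex \<Rightarrow> complex^'n^'n.
          W \<in> L2 \<and> spectral_factor \<Phi> W}"
  then show "AE_circle (\<lambda>z. W z = W_hat \<Phi> \<Psi> V z)"
    unfolding Inf_eq by (rule factor_cost_le(2)[OF \<Phi> \<Psi> V])
qed (auto intro: dH_tilde_respects_ae_rel Metric_space_dH_class scalar_dH_tilde_eq_hellinger)

end
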